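(* Let $b\ge 1$ be an integer, let $K>100$, let $p=p(n)=\frac{\ln^{K} n}{n}$, and let $G\sim \mathcal{G}_{n,p}$. Then a.a.s. $G$ is such that in the $(1:b)$ Maker-Breaker Hamiltonicity game $\mathcal{H}_n(G)$ played on the edge set of $G$, Maker has a strategy to win within $n+o(n)$ moves.
   Context: $\mathcal{G}_{n,p}$ is the binomial random graph on $n$ labelled vertices, in which each pair of vertices is an edge independently with probability $p$. $\ln^{K}n=(\ln n)^{K}$. "A.a.s." means with probability tending to $1$ as $n\to\infty$. The parameters $b,K$ are fixed and $o(n)$ denotes a (deterministic) function $g(n)$ with $g(n)/n\to 0$. Let $X$ be a finite set (the board) and $\mathcal{F}\subseteq 2^X$ (the winning sets). In the $(a:b)$ Maker-Breaker (weak) game $(X,\mathcal{F})$, two players play in rounds; in each round Maker claims $a$ previously unclaimed elements of $X$ and Breaker claims $b$ previously unclaimed elements of $X$ (or all remaining ones if fewer are left). Maker wins as soon as he has claimed all elements of some $F\in\mathcal{F}$; if all elements of $X$ are claimed without this happening, Breaker wins. Breaker moves first and Maker is the second player. The number of moves is the number of Maker's turns. In the Hamiltonicity game $\mathcal{H}_n(G)$ on a graph $G$ with $n$ vertices, the board is $E(G)$ and the winning sets are all edge sets of Hamilton cycles of $G$. *)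

theory Defs
  imports "HOL-Probability.Probability" "HOL-Library.Landau_Symbols"
begin

section \<open>Maker-Breaker games\<close>

text \<open>
  A play is described by Breaker's moves \<open>\<beta> 0, \<beta> 1, \<dots>\<close> and a Maker strategy \<open>\<sigma>\<close>. Breaker moves
  first, and \<open>\<sigma>\<close> maps the list of all Breaker moves so far to Maker's answer; Maker's own earlier
  moves are determined by \<open>\<sigma>\<close>, so this is the same as depending on the full history.
  A play is continued until the board is exhausted (all later moves are empty): once Maker owns a
  winning set he keeps it, so what happens afterwards does not matter.
\<close>

definition maker_move :: "('a set list \<Rightarrow> 'a set) \<Rightarrow> (nat \<Rightarrow> 'a set) \<Rightarrow> nat \<Rightarrow> 'a set" where
  "maker_move \<sigma> \<beta> i = \<sigma> (map \<beta> [0..<Suc i])"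

definition maker_claimed :: "('a set list \<Rightarrow> 'a set) \<Rightarrow> (nat \<Rightarrow> 'a set) \<Rightarrow> nat \<Rightarrow> 'a set" where
  "maker_claimed \<sigma> \<beta> m = (\<Union>i<m. maker_move \<sigma> \<beta> i)"

definition breaker_claimed :: "(nat \<Rightarrow> 'a set) \<Rightarrow> nat \<Rightarrow> 'a set" where
  "breaker_claimed \<beta> m = (\<Union>i<m. \<beta> i)"

definition legal_claim :: "nat \<Rightarrow> 'a set \<Rightarrow> 'a set \<Rightarrow> bool" where
  "legal_claim k free S \<longleftrightarrow> S \<subseteq> free \<and> card S = min k (card free)"

definition legal_breaker_play ::
    "nat \<Rightarrow> 'a set \<Rightarrow> ('a set list \<Rightarrow> 'a set) \<Rightarrow> (nat \<Rightarrow> 'a set) \<Rightarrow> bool" where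
  "legal_breaker_play b X \<sigma> \<beta> \<longleftrightarrow>
     (\<forall>i. legal_claim b (X - (maker_claimed \<sigma> \<beta> i \<union> breaker_claimed \<beta> i)) (\<beta> i))"

definition legal_maker_strategy ::
    "nat \<Rightarrow> nat \<Rightarrow> 'a set \<Rightarrow> ('a set list \<Rightarrow> 'a set) \<Rightarrow> bool" where
  "legal_maker_strategy a b X \<sigma> \<longleftrightarrow>
     (\<forall>\<beta>. legal_breaker_play b X \<sigma> \<beta> \<longrightarrow>
       (\<forall>i. legal_claim a (X - (maker_claimed \<sigma> \<beta> i \<union> breaker_claimed \<beta> (Suc i)))
              (maker_move \<sigma> \<beta> i)))"

text \<open>
  In the \<open>(a:b)\<close> game on the finite board \<open>X\<close> with winning sets \<open>\<F>\<close>, Maker (as second player) has a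
  strategy to win within \<open>t\<close> of his own turns; \<open>t\<close> is real since it need not be an integer.
\<close>

definition maker_wins_within :: "nat \<Rightarrow> nat \<Rightarrow> 'a set \<Rightarrow> 'a set set \<Rightarrow> real \<Rightarrow> bool" where
  "maker_wins_within a b X \<F> t \<longleftrightarrow>
     (\<exists>\<sigma>. legal_maker_strategy a b X \<sigma> \<and>
       (\<forall>\<beta>. legal_breaker_play b X \<sigma> \<beta> \<longrightarrow>
         (\<exists>m. real m \<le> t \<and> (\<exists>F\<in>\<F>. F \<subseteq> maker_claimed \<sigma> \<beta> m))))"


section \<open>Graphs on the vertex set \<open>{..<n}\<close>, given by their edge sets\<close>

definition all_edges :: "nat \<Rightarrow> nat set set" where
  "all_edges n = {e. e \<subseteq> {..<n} \<and> card e = 2}"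

definition cycle_edges :: "'a list \<Rightarrow> 'a set set" where
  "cycle_edges vs = {{vs ! i, vs ! (Suc i mod length vs)} | i. i < length vs}"

definition hamilton_cycles :: "nat \<Rightarrow> nat set set \<Rightarrow> nat set set set" where
  "hamilton_cycles n E =
     {cycle_edges vs | vs. distinct vs \<and> set vs = {..<n} \<and> 3 \<le> length vs \<and> cycle_edges vs \<subseteq> E}"

text \<open>
  The binomial random graph, as a distribution on edge sets. Note that \<^const>\<open>bernoulli_pmf\<close>
  truncates its parameter to \<open>[0,1]\<close>.
\<close>

definition binomial_random_graph :: "nat \<Rightarrow> real \<Rightarrow> nat set set pmf" where
  "binomial_random_graph n p =
     map_pmf (\<lambda>f. {e \<in> all_edges n. f e}) (Pi_pmf (all_edges n) False (\<lambda>_. bernoulli_pmf p))"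

definition asymptotically_almost_surely ::
    "(nat \<Rightarrow> 'a pmf) \<Rightarrow> (nat \<Rightarrow> 'a \<Rightarrow> bool) \<Rightarrow> bool" where
  "asymptotically_almost_surely \<mu> P \<longleftrightarrow>
     (\<lambda>n. measure_pmf.prob (\<mu> n) {x. P n x}) \<longlonglongrightarrow> 1"

end

theory Submission
  imports Defs "HOL-Real_Asymp.Real_Asymp"
begin

text \<open>
  Why Maker wins. With average degree \<open>ln^K n\<close> the random board \<open>G\<close> is so rich
  that any family of \<open>n^O(n)\<close> sets of vertex pairs, each of size about \<open>n^2\<close>
  up to a power of \<open>ln n\<close>, is hit by \<open>G\<close> much more often than Breaker can
  spoil within \<open>O(n)\<close> moves: a single union bound (\<open>prob_not_rich\<close>) gives this
  for two families at once. The first family consists of the pairs between two large disjoint vertex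
  sets. As long as Maker owns many disjoint paths, two of their ends are therefore joined by a free edge
  of \<open>G\<close>; each move merges two paths, none is wasted, and Maker arrives at
  \<open>o(n)\<close> paths.

  To finish, all paths are written one after the other as one list of all vertices with
  \<open>o(n)\<close> \<^emph>\<open>gaps\<close>, that is, consecutive vertices not joined by an edge
  of Maker. Posa rotations of that list with the help of Maker's edges produce many pairs of vertices
  (\<^emph>\<open>boosters\<close>) such that owning any one of them closes the list to a cyclic order
  without creating a gap; cutting the cycle at an old gap then removes this gap. The set of boosters
  depends only on the list and on Maker's at most \<open>2n\<close> edges, so these sets form the second
  family above: a free booster always exists, every move removes a gap, and when there is none left, the
  booster closes a Hamilton cycle.

  Rotations need expansion, which has to be paid for with \<open>o(n)\<close> moves. Only a small set
  \<open>U\<close> of \<open>n / ln^5 n\<close> vertices serves as pivots, so new end points of the list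
  are always neighbours of \<open>U\<close> on the list or path ends, and only \<open>o(n / ln
  n)\<close> vertices ever matter. Each of them needs merely \<open>O(ln n)\<close> edges of Maker into
  \<open>U\<close>, taken from a random subgraph \<open>G\<^sub>1\<close> of \<open>G\<close> that is so
  sparse (degree about \<open>ln^3 n\<close> into \<open>U\<close>) that \<^emph>\<open>every\<close>
  choice of that many edges at each vertex expands sets up to size \<open>n / ln^8 n\<close>
  (\<open>prob_dense_spot\<close>). By Posa's lemma (\<open>Posa_neighbourhood\<close>) this yields
  quadratically many boosters (\<open>many_boosters\<close>).

  Breaker may attack the edges of \<open>G\<^sub>1\<close> at single vertices. Maker ignores that until
  a vertex has lost about half of its degree, and then answers at the endangered vertex of largest
  weight; an exponential potential (\<open>potential_step\<close>) never increases under this rule and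
  shows that no vertex runs dry. Breaker can afford to endanger only \<open>O(n / ln^3 n)\<close>
  vertices, so these answers cost \<open>o(n)\<close> moves in total.
\<close>

section \<open>Winning by maintaining an invariant\<close>

text \<open>
  A positional strategy \<open>f\<close> looks only at Maker's edges, Breaker's edges and Breaker's
  latest move. Since strategies receive Breaker's moves alone, the position is recomputed from them.
\<close>

definition position :: "('a set \<Rightarrow> 'a set \<Rightarrow> 'a set \<Rightarrow> 'a set) \<Rightarrow> 'a set list \<Rightarrow> 'a set \<times> 'a set" where
  "position f = (\<lambda>Ss. fold (\<lambda>S (M, B). (M \<union> f M B S, B \<union> S)) Ss ({}, {}))"

definition positional :: "('a set \<Rightarrow> 'a set \<Rightarrow> 'a set \<Rightarrow> 'a set) \<Rightarrow> 'a set list \<Rightarrow> 'a set" where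
  "positional f Ss = (case position f (butlast Ss) of (M, B) \<Rightarrow> f M B (last Ss))"

lemma position_play:
  "position f (map \<beta> [0..<i]) = (maker_claimed (positional f) \<beta> i, breaker_claimed \<beta> i)"
proof (induction i)
  case 0
  show ?case by (simp add: position_def maker_claimed_def breaker_claimed_def)
next
  case (Suc i)
  have "maker_move (positional f) \<beta> i =
      f (maker_claimed (positional f) \<beta> i) (breaker_claimed \<beta> i) (\<beta> i)"
  proof -
    have "maker_move (positional f) \<beta> i = positional f (map \<beta> [0..<i] @ [\<beta> i])"
      by (simp add: maker_move_def)
    then show ?thesis by (simp add: positional_def[of f "map \<beta> [0..<i] @ [\<beta> i]"] Suc)
  qed
  moreover have "position f (map \<beta> [0..<Suc i]) =
      (case position f (map \<beta> [0..<i]) of (M, B) \<Rightarrow> (M \<union> f M B (\<beta> i), B \<union> \<beta> i))"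
    by (simp add: position_def)
  ultimately show ?case
    using Suc by (auto simp: maker_claimed_def breaker_claimed_def lessThan_Suc)
qed

text \<open>
  This reduces the analysis of the game to single rounds. If Maker can always restore the invariant
  unless he completes a winning set, then he has won by the time the invariant's bound on the number of
  his edges is reached, since each of his moves adds exactly one edge.
\<close>

lemma maker_wins_by_invariant:
  fixes X :: "'a set" and Inv :: "'a set \<Rightarrow> 'a set \<Rightarrow> bool"
  assumes fin: "finite X"
    and init: "Inv {} {}"
    and step: "\<And>M B S. Inv M B \<Longrightarrow> S \<subseteq> X - (M \<union> B) \<Longrightarrow> card S \<le> b \<Longrightarrow>
      \<exists>e \<in> X - (M \<union> B \<union> S). Inv (insert e M) (B \<union> S) \<or> (\<exists>F\<in>\<F>. F \<subseteq> insert e M)"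
    and bound: "\<And>M B. Inv M B \<Longrightarrow> card M < N"
  shows "maker_wins_within 1 b X \<F> (real N)"
proof -
  define won where "won M \<longleftrightarrow> (\<exists>F\<in>\<F>. F \<subseteq> M)" for M
  define good where "good M B S e \<longleftrightarrow>
    e \<in> X - (M \<union> B \<union> S) \<and> (Inv (insert e M) (B \<union> S) \<or> won (insert e M))" for M B S e
  \<comment> \<open>Without a good edge the choice is irrelevant, but it has to be legal nevertheless.\<close>
  define f where "f M B S =
    (if \<exists>e. good M B S e then {SOME e. good M B S e}
     else if X - (M \<union> B \<union> S) = {} then {} else {SOME e. e \<in> X - (M \<union> B \<union> S)})" for M B S
  let ?\<sigma> = "positional f"
  have legal_f: "legal_claim 1 (X - (M \<union> B \<union> S)) (f M B S)" for M B S
  proof (cases "X - (M \<union> B \<union> S) = {}")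
    case True
    then have "f M B S = {}" by (auto simp: f_def good_def)
    then show ?thesis unfolding legal_claim_def True by simp
  next
    case False
    have "card (X - (M \<union> B \<union> S)) > 0"
      using False fin by (simp add: card_gt_0_iff)
    moreover have "(SOME e. good M B S e) \<in> X - (M \<union> B \<union> S)" if "\<exists>e. good M B S e"
      using someI_ex[OF that] by (simp add: good_def)
    moreover have "(SOME e. e \<in> X - (M \<union> B \<union> S)) \<in> X - (M \<union> B \<union> S)"
      using False by (metis all_not_in_conv some_in_eq)
    ultimately show ?thesis
      using False by (auto simp: legal_claim_def f_def)
  qed
  have move: "maker_move ?\<sigma> \<beta> i = f (maker_claimed ?\<sigma> \<beta> i) (breaker_claimed \<beta> i) (\<beta> i)"
    for \<beta> :: "nat \<Rightarrow> 'a set" and i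
  proof -
    have "maker_move ?\<sigma> \<beta> i = positional f (map \<beta> [0..<i] @ [\<beta> i])"
      by (simp add: maker_move_def)
    then show ?thesis by (simp add: positional_def[of f "map \<beta> [0..<i] @ [\<beta> i]"] position_play)
  qed
  have legal: "legal_maker_strategy 1 b X ?\<sigma>"
    unfolding legal_maker_strategy_def
  proof (intro allI impI)
    fix \<beta> :: "nat \<Rightarrow> 'a set" and i
    have "breaker_claimed \<beta> (Suc i) = breaker_claimed \<beta> i \<union> \<beta> i"
      by (auto simp: breaker_claimed_def lessThan_Suc)
    then show "legal_claim 1 (X - (maker_claimed ?\<sigma> \<beta> i \<union> breaker_claimed \<beta> (Suc i)))
        (maker_move ?\<sigma> \<beta> i)"
      using legal_f[of "maker_claimed ?\<sigma> \<beta> i" "breaker_claimed \<beta> i" "\<beta> i"] move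
      by (simp add: Un_assoc)
  qed
  have "\<exists>m\<le>N. won (maker_claimed ?\<sigma> \<beta> m)" if play: "legal_breaker_play b X ?\<sigma> \<beta>" for \<beta>
  proof (rule ccontr)
    assume not_won: "\<not> ?thesis"
    have "i \<le> N \<Longrightarrow> Inv (maker_claimed ?\<sigma> \<beta> i) (breaker_claimed \<beta> i) \<and>
        finite (maker_claimed ?\<sigma> \<beta> i) \<and> card (maker_claimed ?\<sigma> \<beta> i) = i" for i
    proof (induction i)
      case 0
      then show ?case using init by (simp add: maker_claimed_def breaker_claimed_def)
    next
      case (Suc i)
      define M B where "M = maker_claimed ?\<sigma> \<beta> i" and "B = breaker_claimed \<beta> i"
      have M': "maker_claimed ?\<sigma> \<beta> (Suc i) = M \<union> f M B (\<beta> i)"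
        using move[of \<beta> i] by (auto simp: M_def B_def maker_claimed_def lessThan_Suc)
      have B': "breaker_claimed \<beta> (Suc i) = B \<union> \<beta> i"
        by (auto simp: B_def breaker_claimed_def lessThan_Suc)
      have IH: "Inv M B" "finite M" "card M = i"
        using Suc by (auto simp: M_def B_def)
      have "legal_claim b (X - (M \<union> B)) (\<beta> i)"
        using play by (simp add: legal_breaker_play_def M_def B_def)
      then have "\<exists>e. good M B (\<beta> i) e"
        using step[OF IH(1), of "\<beta> i"] by (auto simp: legal_claim_def good_def won_def)
      then obtain e where e: "f M B (\<beta> i) = {e}" "good M B (\<beta> i) e"
        unfolding f_def by (metis someI_ex)
      have "\<not> won (insert e M)"
        using not_won Suc.prems M' e(1) by auto
      then show ?case
        using e IH M' B' by (auto simp: good_def)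
    qed
    then show False using bound[of "maker_claimed ?\<sigma> \<beta> N" "breaker_claimed \<beta> N"] by auto
  qed
  then show ?thesis
    unfolding maker_wins_within_def won_def
    by (intro exI[of _ ?\<sigma>] conjI legal) (meson of_nat_le_iff)
qed

section \<open>Degrees into a vertex set\<close>

lemma card_doubleton_le: "card {x, y} \<le> 2"
  by (simp add: card_insert_if)

text \<open>An unordered pair stems from at most two ordered ones.\<close>

lemma card_pairs_le:
  assumes "finite R"
  shows "card R \<le> 2 * card ((\<lambda>(a, c). {a, c}) ` R)"
proof -
  let ?f = "\<lambda>(a, c). {a, c}"
  have "R \<subseteq> (\<Union>e \<in> ?f ` R. {r \<in> R. ?f r = e})" by auto
  then have "card R \<le> card (\<Union>e \<in> ?f ` R. {r \<in> R. ?f r = e})"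
    using assms by (intro card_mono) auto
  also have "\<dots> \<le> (\<Sum>e \<in> ?f ` R. card {r \<in> R. ?f r = e})"
    using assms by (intro card_UN_le) auto
  also have "\<dots> \<le> (\<Sum>e \<in> ?f ` R. 2)"
  proof (rule sum_mono)
    fix e assume "e \<in> ?f ` R"
    then obtain a c where e: "e = {a, c}" by auto
    have "{r \<in> R. ?f r = e} \<subseteq> {(a, c), (c, a)}"
    proof
      fix r assume r: "r \<in> {r \<in> R. ?f r = e}"
      obtain y z where "r = (y, z)" by (cases r)
      with r have "{y, z} = {a, c}" by (simp add: e)
      then show "r \<in> {(a, c), (c, a)}" by (simp add: doubleton_eq_iff \<open>r = (y, z)\<close>)
    qed
    then have "card {r \<in> R. ?f r = e} \<le> card {(a, c), (c, a)}"
      by (rule card_mono[rotated]) simp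
    also have "\<dots> \<le> 2" by (rule card_doubleton_le)
    finally show "card {r \<in> R. ?f r = e} \<le> 2" .
  qed
  finally show ?thesis by simp
qed

definition deg_into :: "'a set \<Rightarrow> 'a set set \<Rightarrow> 'a \<Rightarrow> nat" where
  "deg_into U E v = card {x \<in> U. {v, x} \<in> E}"

lemma deg_into_mono: "finite U \<Longrightarrow> E \<subseteq> E' \<Longrightarrow> deg_into U E v \<le> deg_into U E' v"
  unfolding deg_into_def by (intro card_mono) auto

lemma deg_into_Un_le: "finite U \<Longrightarrow> deg_into U (E \<union> E') v \<le> deg_into U E v + deg_into U E' v"
  unfolding deg_into_def
  by (rule order_trans[OF card_mono card_Un_le]) auto

lemma deg_into_insert_new:
  assumes "finite U" "x \<in> U" "{v, x} \<notin> E"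
  shows "deg_into U (insert {v, x} E) v \<ge> Suc (deg_into U E v)"
proof -
  have "Suc (card {y \<in> U. {v, y} \<in> E}) = card (insert x {y \<in> U. {v, y} \<in> E})"
    using assms by auto
  also have "\<dots> \<le> card {y \<in> U. {v, y} \<in> insert {v, x} E}"
    using assms by (intro card_mono) auto
  finally show ?thesis by (simp add: deg_into_def)
qed

lemma deg_into_le_card:
  assumes "finite E"
  shows "deg_into U E v \<le> card E"
  unfolding deg_into_def
proof (rule card_inj_on_le[of "\<lambda>x. {v, x}"])
  show "inj_on (\<lambda>x. {v, x}) {x \<in> U. {v, x} \<in> E}"
    by (auto simp: inj_on_def doubleton_eq_iff)
qed (use assms in auto)

lemma sum_deg_into:
  assumes "finite S" "finite U"
  shows "(\<Sum>v\<in>S. deg_into U E v) = card {(v, x) \<in> S \<times> U. {v, x} \<in> E}"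
proof -
  have "{(v, x) \<in> S \<times> U. {v, x} \<in> E} = Sigma S (\<lambda>v. {x \<in> U. {v, x} \<in> E})" by auto
  then show ?thesis using assms by (simp add: deg_into_def)
qed

lemma sum_deg_into_le:
  assumes "finite S" "finite U" "finite E"
  shows "(\<Sum>v\<in>S. deg_into U E v) \<le> 2 * card E"
proof -
  let ?R = "{(v, x) \<in> S \<times> U. {v, x} \<in> E}"
  have "finite ?R"
    using assms by (intro finite_subset[of ?R "S \<times> U"]) auto
  then have "card ?R \<le> 2 * card ((\<lambda>(a, c). {a, c}) ` ?R)"
    by (rule card_pairs_le)
  also have "card ((\<lambda>(a, c). {a, c}) ` ?R) \<le> card E"
    using assms by (intro card_mono) auto
  finally show ?thesis using assms by (simp add: sum_deg_into)
qed

section \<open>Rotations of spanning lists\<close>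

text \<open>
  A list of all vertices is read as a Hamilton path some of whose edges are only imagined; these are the
  gaps that Maker still has to remove.
\<close>

fun gaps :: "'a set set \<Rightarrow> 'a list \<Rightarrow> nat" where
  "gaps M (x # y # zs) = (if {x, y} \<in> M then 0 else 1) + gaps M (y # zs)"
| "gaps M _ = 0"

lemma gaps_Cons:
  "gaps M (x # ys) = (if ys = [] \<or> {x, hd ys} \<in> M then 0 else 1) + gaps M ys"
  by (cases ys) auto

lemma gaps_append:
  "gaps M (xs @ ys) = gaps M xs + gaps M ys +
     (if xs = [] \<or> ys = [] \<or> {last xs, hd ys} \<in> M then 0 else 1)"
  by (induction xs) (auto simp: gaps_Cons)

lemma gaps_rev [simp]: "gaps M (rev xs) = gaps M xs"
  by (induction xs) (auto simp: gaps_Cons gaps_append last_rev insert_commute)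

lemma gaps_mono: "M \<subseteq> M' \<Longrightarrow> gaps M' xs \<le> gaps M xs"
  by (induction xs) (auto simp: gaps_Cons)

lemma gaps_le_length: "gaps M xs \<le> length xs"
  by (induction xs) (auto simp: gaps_Cons)

lemma gaps_pos_split:
  "gaps M L > 0 \<Longrightarrow> \<exists>xs ys. L = xs @ ys \<and> xs \<noteq> [] \<and> ys \<noteq> [] \<and> {last xs, hd ys} \<notin> M"
proof (induction L)
  case (Cons x L)
  show ?case
  proof (cases "L \<noteq> [] \<and> {x, hd L} \<notin> M")
    case True
    then show ?thesis by (intro exI[of _ "[x]"] exI[of _ L]) auto
  next
    case False
    then obtain xs ys where "L = xs @ ys" "xs \<noteq> []" "ys \<noteq> []" "{last xs, hd ys} \<notin> M"
      using Cons by (auto simp: gaps_Cons)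
    then show ?thesis by (intro exI[of _ "x # xs"] exI[of _ ys]) auto
  qed
qed auto

lemma gaps_zero_nth:
  "gaps M L = 0 \<Longrightarrow> Suc i < length L \<Longrightarrow> {L ! i, L ! Suc i} \<in> M"
proof (induction L arbitrary: i)
  case (Cons x L)
  then show ?case
    by (cases i; cases L) (auto simp: gaps_Cons split: if_splits)
qed auto

text \<open>
  Posa rotations at the head of a list: an edge from the head to the pivot \<open>x\<close> allows
  reversing the part before \<open>x\<close>, after which the former predecessor of \<open>x\<close> is
  the head. The last element stays fixed. Pivots are restricted to \<open>U\<close>, so that a rotation
  only breaks pairs that contain a vertex of \<open>U\<close>.
\<close>

inductive_set rotations :: "'a set \<Rightarrow> 'a set set \<Rightarrow> 'a list \<Rightarrow> 'a list set"
  for U H L where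
  rotations_refl: "L \<in> rotations U H L"
| rotations_step: "xs @ x # ys \<in> rotations U H L \<Longrightarrow> xs \<noteq> [] \<Longrightarrow> x \<in> U \<Longrightarrow> {hd xs, x} \<in> H \<Longrightarrow>
    rev xs @ x # ys \<in> rotations U H L"

lemma rotations_same_set:
  "L' \<in> rotations U H L \<Longrightarrow> set L' = set L \<and> length L' = length L \<and> last L' = last L"
  by (induction rule: rotations.induct) auto

lemma rotations_distinct: "L' \<in> rotations U H L \<Longrightarrow> distinct L \<Longrightarrow> distinct L'"
  by (induction rule: rotations.induct) auto

text \<open>A rotation exchanges one consecutive pair for an edge of \<open>H\<close>, so it cannot open a gap.\<close>

lemma rotations_gaps: "L' \<in> rotations U H L \<Longrightarrow> H \<subseteq> M \<Longrightarrow> gaps M L' \<le> gaps M L"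
  by (induction rule: rotations.induct)
     (auto simp: gaps_append gaps_Cons last_rev split: if_splits)

fun neighbours_in :: "'a list \<Rightarrow> 'a \<Rightarrow> 'a set" where
  "neighbours_in (a # c # L) x =
     (if x = a then {c} else {}) \<union> (if x = c then {a} else {}) \<union> neighbours_in (c # L) x"
| "neighbours_in _ x = {}"

lemma neighbours_in_Cons:
  "neighbours_in (a # L) x = neighbours_in L x \<union>
     (if L \<noteq> [] \<and> x = a then {hd L} else {}) \<union> (if L \<noteq> [] \<and> x = hd L then {a} else {})"
  by (cases L) auto

lemma neighbours_in_append:
  "neighbours_in (xs @ ys) x = neighbours_in xs x \<union> neighbours_in ys x \<union>
     (if xs \<noteq> [] \<and> ys \<noteq> [] \<and> x = last xs then {hd ys} else {}) \<union>
     (if xs \<noteq> [] \<and> ys \<noteq> [] \<and> x = hd ys then {last xs} else {})"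
  by (induction xs) (auto simp: neighbours_in_Cons)

lemma neighbours_in_rev [simp]: "neighbours_in (rev xs) x = neighbours_in xs x"
  by (induction xs) (auto simp: neighbours_in_Cons neighbours_in_append last_rev)

lemma neighbours_in_sym: "y \<in> neighbours_in L x \<longleftrightarrow> x \<in> neighbours_in L y"
  by (induction L) (auto simp: neighbours_in_Cons)

lemma neighbours_in_subset: "neighbours_in L x \<subseteq> set L"
  by (induction L) (auto simp: neighbours_in_Cons)

lemma neighbours_in_notin: "x \<notin> set L \<Longrightarrow> neighbours_in L x = {}"
  by (induction L) (auto simp: neighbours_in_Cons)

lemma card_neighbours_in:
  assumes "distinct L"
  shows "card (neighbours_in L x) \<le> 2"
proof (cases "x \<in> set L")
  case False
  then show ?thesis by (simp add: neighbours_in_notin)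
next
  case True
  then obtain us vs where L: "L = us @ x # vs" by (meson split_list)
  have none: "neighbours_in us x = {}" "neighbours_in vs x = {}"
    using assms L by (simp_all add: neighbours_in_notin)
  have "neighbours_in L x \<subseteq> {last us, hd vs}"
    using assms unfolding L by (auto simp: neighbours_in_append neighbours_in_Cons none split: if_splits)
  then have "card (neighbours_in L x) \<le> card {last us, hd vs}" by (intro card_mono) auto
  also have "\<dots> \<le> 2" by (rule card_doubleton_le)
  finally show ?thesis .
qed

text \<open>
  A rotation changes the list neighbours of three elements only: the old head, the new head and the
  pivot. The first two are heads, and the pivot loses the new head as a neighbour. Hence an element that
  is neither a head nor, in the original list, next to one is never affected.
\<close>

lemma rotations_keep_neighbours:
  assumes "L' \<in> rotations U H L" and "x \<notin> hd ` rotations U H L"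
    and "neighbours_in L x \<inter> hd ` rotations U H L = {}"
  shows "neighbours_in L' x = neighbours_in L x"
  using assms(1)
proof (induction rule: rotations.induct)
  case (rotations_step xs z ys)
  let ?S = "hd ` rotations U H L"
  have "rev xs @ z # ys \<in> rotations U H L"
    using rotations_step.hyps by (intro rotations.rotations_step) auto
  then have "hd (rev xs @ z # ys) \<in> ?S" by (rule imageI)
  then have last: "last xs \<in> ?S" using rotations_step.hyps by (simp add: hd_rev)
  have "hd (xs @ z # ys) \<in> ?S" using rotations_step.hyps by (intro imageI) auto
  then have hd: "hd xs \<in> ?S" using rotations_step.hyps by simp
  have "x \<noteq> z"
  proof
    assume "x = z"
    then have "last xs \<in> neighbours_in (xs @ z # ys) x"
      using rotations_step.hyps by (simp add: neighbours_in_append)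
    then show False using rotations_step.IH last assms(3) by auto
  qed
  moreover have "x \<noteq> last xs" "x \<noteq> hd xs" using last hd assms(2) by auto
  ultimately have "neighbours_in (rev xs @ z # ys) x = neighbours_in (xs @ z # ys) x"
    using rotations_step.hyps(2) by (simp add: neighbours_in_append last_rev)
  then show ?case using rotations_step.IH by simp
qed simp

text \<open>
  Posa's lemma. If \<open>x\<close> is joined to a head, then rotating with pivot \<open>x\<close> makes
  its current predecessor a head. Were \<open>x\<close> far from all heads in \<open>L\<close>, its
  predecessor would still be the one from \<open>L\<close>, a contradiction. So all such
  \<open>x\<close> are heads or among the two neighbours of one.
\<close>

lemma Posa_neighbourhood:
  fixes L :: "'a list" and U :: "'a set" and H :: "'a set set"
  assumes "distinct L" "U \<subseteq> set L"
  defines "S \<equiv> hd ` rotations U H L"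
  shows "card {x \<in> U. \<exists>a\<in>S. {a, x} \<in> H} \<le> 3 * card S"
proof -
  have S_sub: "S \<subseteq> set L" if "L \<noteq> []"
    using that rotations_same_set[of _ U H L] unfolding S_def
    by (metis image_subsetI hd_in_set length_0_conv)
  have fS: "finite S"
  proof (cases "L = []")
    case True
    then have "S \<subseteq> {hd []}" using rotations_same_set[of _ U H L] by (auto simp: S_def)
    then show ?thesis by (rule finite_subset) auto
  qed (use S_sub finite_subset in auto)
  have "{x \<in> U. \<exists>a\<in>S. {a, x} \<in> H} \<subseteq> S \<union> (\<Union>y\<in>S. neighbours_in L y)"
  proof
    fix x assume "x \<in> {x \<in> U. \<exists>a\<in>S. {a, x} \<in> H}"
    then obtain L' where x: "x \<in> U" and L': "L' \<in> rotations U H L" and H: "{hd L', x} \<in> H"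
      by (auto simp: S_def)
    show "x \<in> S \<union> (\<Union>y\<in>S. neighbours_in L y)"
    proof (rule ccontr)
      assume neg: "x \<notin> S \<union> (\<Union>y\<in>S. neighbours_in L y)"
      have "x \<in> set L'" using x assms(2) rotations_same_set[OF L'] by auto
      then obtain xs ys where split: "L' = xs @ x # ys" by (meson split_list)
      have "hd L' \<in> S" using L' by (simp add: S_def)
      then have "xs \<noteq> []" using neg split by auto
      then have "rev xs @ x # ys \<in> rotations U H L"
        using L' split x H by (intro rotations_step) auto
      then have "hd (rev xs @ x # ys) \<in> S" unfolding S_def by (rule imageI)
      then have "last xs \<in> S" using \<open>xs \<noteq> []\<close> by (simp add: hd_rev)
      moreover have "last xs \<in> neighbours_in L' x"
        using \<open>xs \<noteq> []\<close> split by (simp add: neighbours_in_append)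
      moreover have "neighbours_in L' x = neighbours_in L x"
        using L' neg neighbours_in_sym[of _ L x] unfolding S_def
        by (intro rotations_keep_neighbours) auto
      ultimately show False using neg neighbours_in_sym[of _ L x] by auto
    qed
  qed
  then have "card {x \<in> U. \<exists>a\<in>S. {a, x} \<in> H} \<le> card (S \<union> (\<Union>y\<in>S. neighbours_in L y))"
    using fS by (intro card_mono) (auto intro: finite_subset[OF neighbours_in_subset])
  also have "\<dots> \<le> card S + (\<Sum>y\<in>S. card (neighbours_in L y))"
    using fS by (intro order_trans[OF card_Un_le] add_left_mono card_UN_le)
  also have "(\<Sum>y\<in>S. card (neighbours_in L y)) \<le> (\<Sum>y\<in>S. 2)"
    using assms(1) by (intro sum_mono card_neighbours_in)
  finally show ?thesis by simp
qed

text \<open>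
  The end pairs obtained by rotating first one end of the list and then, after a reversal, the other
  one. Claiming such a pair closes a rotated list to a cycle.
\<close>

definition boosters :: "'a set \<Rightarrow> 'a set set \<Rightarrow> 'a list \<Rightarrow> 'a set set" where
  "boosters U H L =
     {{hd L', last L'} | L' L''. L'' \<in> rotations U H L \<and> L' \<in> rotations U H (rev L'')}"

text \<open>
  A relation between consecutive elements survives rotations if it holds for all pairs of a good element
  (in \<open>W\<close>) and a pivot, and if whatever stands next to a pivot is good. The new head stood
  next to the pivot, so heads stay good, too.
\<close>

lemma rotations_successively:
  assumes "L' \<in> rotations U H L" and "successively R L"
    and sym: "\<And>y z. R y z \<Longrightarrow> R z y"
    and piv: "\<And>y x. R y x \<Longrightarrow> x \<in> U \<Longrightarrow> y \<in> W"
    and new: "\<And>y x. y \<in> W \<Longrightarrow> x \<in> U \<Longrightarrow> R y x"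
    and "hd L \<in> W"
  shows "successively R L' \<and> hd L' \<in> W"
  using assms(1)
proof (induction rule: rotations.induct)
  case rotations_refl
  show ?case using assms(2,6) by blast
next
  case (rotations_step xs x ys)
  have "successively R xs" using rotations_step.IH by (simp add: successively_append_iff)
  then have "successively (\<lambda>y z. R z y) xs" by (rule successively_mono) (rule sym)
  then have rev: "successively R (rev xs)" by simp
  have "R (last xs) x" "R (hd xs) x" "successively R (x # ys)"
    using rotations_step new by (auto simp: successively_append_iff)
  then show ?case
    using rev rotations_step.hyps piv
    by (auto simp: successively_append_iff last_rev hd_rev)
qed

text \<open>
  If every set of at most \<open>s\<close> good vertices expands by a factor of more than three, then
  Posa's lemma rules out that there are only \<open>s\<close> heads.
\<close>

lemma many_rotation_heads:
  assumes L: "distinct L" "U \<subseteq> set L" and fin: "finite U"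
    and heads: "hd ` rotations U H L \<subseteq> W"
    and deg: "\<And>v. v \<in> W \<Longrightarrow> D \<le> deg_into U H v"
    and sparse: "\<And>S T. S \<subseteq> W \<Longrightarrow> T \<subseteq> U \<Longrightarrow> S \<noteq> {} \<Longrightarrow> card S \<le> s \<Longrightarrow> card T \<le> 3 * card S \<Longrightarrow>
      card {(v, x) \<in> S \<times> T. {v, x} \<in> H} < D * card S"
    and "finite W"
  shows "s < card (hd ` rotations U H L)"
proof (rule ccontr)
  assume small: "\<not> ?thesis"
  define S where "S = hd ` rotations U H L"
  define T where "T = {x \<in> U. \<exists>a\<in>S. {a, x} \<in> H}"
  have "S \<noteq> {}" using rotations_refl by (auto simp: S_def)
  have fS: "finite S" unfolding S_def using heads \<open>finite W\<close> by (rule finite_subset)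
  have T: "card T \<le> 3 * card S"
    unfolding T_def S_def using L by (rule Posa_neighbourhood)
  have "D * card S \<le> (\<Sum>v\<in>S. deg_into U H v)"
    using sum_bounded_below[of S D "deg_into U H"] deg heads by (auto simp: S_def mult.commute)
  also have "\<dots> = card {(v, x) \<in> S \<times> U. {v, x} \<in> H}"
    using fS fin by (rule sum_deg_into)
  also have "{(v, x) \<in> S \<times> U. {v, x} \<in> H} = {(v, x) \<in> S \<times> T. {v, x} \<in> H}"
    by (auto simp: T_def)
  also have "card \<dots> < D * card S"
    using small heads T \<open>S \<noteq> {}\<close> by (intro sparse) (auto simp: S_def T_def)
  finally show False by simp
qed

lemma many_boosters:
  assumes L: "L \<noteq> []"
    and heads: "s \<le> card (hd ` rotations U H L)"
    and tails: "\<And>L'. L' \<in> rotations U H L \<Longrightarrow> s \<le> card (hd ` rotations U H (rev L'))"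
  shows "s\<^sup>2 \<le> 2 * card (boosters U H L)"
proof -
  define A where "A = hd ` rotations U H L"
  have "\<forall>a\<in>A. \<exists>L'. L' \<in> rotations U H L \<and> hd L' = a" by (auto simp: A_def)
  then obtain f where f: "\<And>a. a \<in> A \<Longrightarrow> f a \<in> rotations U H L \<and> hd (f a) = a" by metis
  define C where "C a = hd ` rotations U H (rev (f a))" for a
  have sub: "hd ` rotations U H L1 \<subseteq> set L1" if "L1 \<noteq> []" for L1
    using that rotations_same_set[of _ U H L1]
    by (metis image_subsetI hd_in_set length_0_conv)
  have ne: "f a \<noteq> []" if "a \<in> A" for a
    using rotations_same_set[of "f a" U H L] f[OF that] L by auto
  have fA: "finite A" unfolding A_def by (rule finite_subset[OF sub[OF L]]) simp
  have fC: "finite (C a)" if "a \<in> A" for a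
    unfolding C_def by (rule finite_subset[OF sub]) (use ne[OF that] in auto)
  have "s\<^sup>2 \<le> card A * s" using heads by (simp add: A_def power2_eq_square)
  also have "\<dots> = (\<Sum>a\<in>A. s)" by simp
  also have "\<dots> \<le> (\<Sum>a\<in>A. card (C a))" using f tails by (intro sum_mono) (simp add: C_def)
  also have "\<dots> = card (Sigma A C)" using fA fC by simp
  also have "\<dots> \<le> 2 * card ((\<lambda>(a, c). {a, c}) ` Sigma A C)"
    using fA fC by (intro card_pairs_le) auto
  also have "card ((\<lambda>(a, c). {a, c}) ` Sigma A C) \<le> card (boosters U H L)"
  proof (rule card_mono)
    have "boosters U H L \<subseteq> Pow (set L)"
    proof
      fix e assume "e \<in> boosters U H L"
      then obtain L1 L2 where e: "e = {hd L1, last L1}" and L2: "L2 \<in> rotations U H L"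
        and L1: "L1 \<in> rotations U H (rev L2)" by (auto simp: boosters_def)
      have "set L1 = set L" "L1 \<noteq> []"
        using rotations_same_set[OF L2] rotations_same_set[OF L1] L by auto
      then have "hd L1 \<in> set L" "last L1 \<in> set L"
        using hd_in_set[of L1] last_in_set[of L1] by auto
      then show "e \<in> Pow (set L)" unfolding e by blast
    qed
    then show "finite (boosters U H L)" by (rule finite_subset) simp
    show "(\<lambda>(a, c). {a, c}) ` Sigma A C \<subseteq> boosters U H L"
    proof
      fix e assume "e \<in> (\<lambda>(a, c). {a, c}) ` Sigma A C"
      then obtain a L1 where a: "a \<in> A" and L1: "L1 \<in> rotations U H (rev (f a))"
        and e: "e = {a, hd L1}" by (auto simp: C_def)
      have "last L1 = a"
        using rotations_same_set[OF L1] f[OF a] by (simp add: last_rev)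
      then show "e \<in> boosters U H L"
        using f[OF a] L1 e by (auto simp: boosters_def insert_commute)
    qed
  qed
  finally show ?thesis by simp
qed

section \<open>A potential that protects attacked vertices\<close>

text \<open>
  The weight of a vertex at which Maker owns \<open>dM\<close> and Breaker \<open>dB\<close> of the
  relevant edges. It vanishes once Maker owns \<open>D\<close> of them, it halves with each edge of
  Maker, and edges of Breaker only count beyond the threshold \<open>\<tau>\<close>. The base exceeds 1
  so little that \<open>2 * b\<close> edges of Breaker, each of relative effect at most \<open>1 / (4 *
  b)\<close>, are outweighed by one edge of Maker.
\<close>

definition danger :: "nat \<Rightarrow> nat \<Rightarrow> nat \<Rightarrow> nat \<Rightarrow> nat \<Rightarrow> real" where
  "danger b D \<tau> dM dB =
     (if dM < D then (4 * real b / (4 * real b - 1)) ^ (dB - \<tau>) / 2 ^ dM else 0)"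

lemma danger_nonneg: "b \<ge> 1 \<Longrightarrow> danger b D \<tau> dM dB \<ge> 0"
  by (simp add: danger_def)

lemma danger_antimono:
  assumes "dM \<le> dM'" "b \<ge> 1"
  shows "danger b D \<tau> dM' dB \<le> danger b D \<tau> dM dB"
  using assms by (auto simp: danger_def intro!: divide_left_mono power_increasing)

lemma danger_halves:
  assumes "b \<ge> 1" "Suc dM \<le> dM'"
  shows "danger b D \<tau> dM' dB \<le> danger b D \<tau> dM dB / 2"
proof -
  have "danger b D \<tau> dM' dB \<le> danger b D \<tau> (Suc dM) dB"
    using assms by (intro danger_antimono)
  also have "\<dots> \<le> danger b D \<tau> dM dB / 2"
    using assms by (simp add: danger_def)
  finally show ?thesis .
qed

text \<open>
  With \<open>x = 4b / (4b - 1)\<close>, that is \<open>1 / x = 1 - 1 / (4b)\<close>, this is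
  Bernoulli's inequality for the power \<open>(1 / x) ^ \<delta>\<close>.
\<close>

lemma danger_increase:
  assumes b: "b \<ge> 1"
  shows "danger b D \<tau> dM (d + \<delta>) - danger b D \<tau> dM d \<le> danger b D \<tau> dM (d + \<delta>) * (\<delta> / (4 * real b))"
proof (cases "dM < D")
  case True
  define x where "x = 4 * real b / (4 * real b - 1)"
  have x: "x \<ge> 1" "inverse x = 1 - 1 / (4 * b)"
    using b by (auto simp: x_def field_simps)
  have "1 - \<delta> * (1 / (4 * real b)) \<le> (1 + - (1 / (4 * real b))) ^ \<delta>"
    using Bernoulli_inequality[of "- (1 / (4 * real b))" \<delta>] b by (simp add: field_simps)
  also have "\<dots> = inverse x ^ \<delta>" by (simp add: x)
  finally have "x ^ (d + \<delta> - \<tau>) * (1 - \<delta> / (4 * real b)) \<le> x ^ (d + \<delta> - \<tau>) * inverse x ^ \<delta>"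
    using x(1) by (intro mult_left_mono) auto
  also have "\<dots> \<le> (x ^ (d - \<tau>) * x ^ \<delta>) * inverse x ^ \<delta>"
  proof (rule mult_right_mono)
    show "x ^ (d + \<delta> - \<tau>) \<le> x ^ (d - \<tau>) * x ^ \<delta>"
      using x(1) by (auto simp flip: power_add intro: power_increasing)
    show "0 \<le> inverse x ^ \<delta>" using x(1) by (intro zero_le_power) simp
  qed
  also have "\<dots> = x ^ (d - \<tau>)"
    using x(1) by (simp add: power_mult_distrib[symmetric])
  finally have "x ^ (d + \<delta> - \<tau>) - x ^ (d - \<tau>) \<le> x ^ (d + \<delta> - \<tau>) * (\<delta> / (4 * real b))"
    by (simp add: algebra_simps)
  then have "(x ^ (d + \<delta> - \<tau>) - x ^ (d - \<tau>)) / 2 ^ dM \<le> x ^ (d + \<delta> - \<tau>) * (\<delta> / (4 * real b)) / 2 ^ dM"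
    by (intro divide_right_mono) auto
  then show ?thesis using True by (simp add: danger_def x_def diff_divide_distrib mult_ac)
qed (simp add: danger_def)

text \<open>
  Let \<open>w\<close> be the largest weight above the threshold after Breaker's move. That move has
  added at most \<open>w * 2b / (4b) = w / 2\<close> to the potential, and Maker's answer at a vertex of
  weight \<open>w\<close> takes away at least \<open>w / 2\<close>.
\<close>

lemma potential_step:
  fixes dM dM' dB \<delta> :: "'a \<Rightarrow> nat"
  assumes b: "b \<ge> 1" and fin: "finite V" and v: "v \<in> V"
    and total: "(\<Sum>u\<in>V. \<delta> u) \<le> 2 * b"
    and mono: "\<And>u. u \<in> V \<Longrightarrow> dM u \<le> dM' u"
    and max: "\<And>u. u \<in> V \<Longrightarrow> \<tau> < dB u + \<delta> u \<Longrightarrow>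
      danger b D \<tau> (dM u) (dB u + \<delta> u) \<le> danger b D \<tau> (dM v) (dB v + \<delta> v)"
    and answer: "dM v < dM' v"
  shows "(\<Sum>u\<in>V. danger b D \<tau> (dM' u) (dB u + \<delta> u)) \<le> (\<Sum>u\<in>V. danger b D \<tau> (dM u) (dB u))"
proof -
  define w where "w = danger b D \<tau> (dM v) (dB v + \<delta> v)"
  let ?new = "\<lambda>u. danger b D \<tau> (dM u) (dB u + \<delta> u)" and ?old = "\<lambda>u. danger b D \<tau> (dM u) (dB u)"
  have w0: "w \<ge> 0" unfolding w_def using b by (rule danger_nonneg)
  have incr: "?new u \<le> ?old u + w * (\<delta> u / (4 * real b))" if "u \<in> V" for u
  proof (cases "\<tau> < dB u + \<delta> u")
    case True
    have "?new u - ?old u \<le> ?new u * (\<delta> u / (4 * real b))" using b by (rule danger_increase)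
    also have "\<dots> \<le> w * (\<delta> u / (4 * real b))"
      using max[OF that True] by (intro mult_right_mono) (auto simp: w_def)
    finally show ?thesis by simp
  next
    case False
    then have "?new u = ?old u" by (simp add: danger_def)
    moreover have "w * (\<delta> u / (4 * real b)) \<ge> 0" using w0 by simp
    ultimately show ?thesis by linarith
  qed
  have "(\<Sum>u\<in>V. danger b D \<tau> (dM' u) (dB u + \<delta> u)) =
      danger b D \<tau> (dM' v) (dB v + \<delta> v) + (\<Sum>u\<in>V - {v}. danger b D \<tau> (dM' u) (dB u + \<delta> u))"
    using fin v by (simp add: sum.remove)
  also have "\<dots> \<le> w / 2 + (\<Sum>u\<in>V - {v}. ?new u)"
    unfolding w_def using b mono answer
    by (intro add_mono sum_mono danger_halves danger_antimono) auto
  also have "\<dots> = (\<Sum>u\<in>V. ?new u) - w / 2"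
    using fin v by (simp add: sum.remove[of V v] w_def)
  also have "(\<Sum>u\<in>V. ?new u) \<le> (\<Sum>u\<in>V. ?old u + w * (\<delta> u / (4 * real b)))"
    using incr by (rule sum_mono)
  also have "\<dots> = (\<Sum>u\<in>V. ?old u) + w * (real (\<Sum>u\<in>V. \<delta> u) / (4 * real b))"
    by (simp add: sum.distrib sum_distrib_left sum_divide_distrib)
  also have "\<dots> \<le> (\<Sum>u\<in>V. ?old u) + w * (real (2 * b) / (4 * real b))"
    using total w0 b by (intro add_left_mono mult_left_mono divide_right_mono) (auto simp del: of_nat_mult of_nat_sum)
  also have "\<dots> = (\<Sum>u\<in>V. ?old u) + w / 2" using b by simp
  finally show ?thesis by simp
qed

text \<open>
  When no needy vertex is above the threshold, Breaker's edges have not yet counted and Maker is free to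
  play elsewhere.
\<close>

lemma potential_idle:
  fixes dM dM' dB \<delta> :: "'a \<Rightarrow> nat"
  assumes b: "b \<ge> 1"
    and mono: "\<And>u. u \<in> V \<Longrightarrow> dM u \<le> dM' u"
    and safe: "\<And>u. u \<in> V \<Longrightarrow> dM u < D \<Longrightarrow> dB u + \<delta> u \<le> \<tau>"
  shows "(\<Sum>u\<in>V. danger b D \<tau> (dM' u) (dB u + \<delta> u)) \<le> (\<Sum>u\<in>V. danger b D \<tau> (dM u) (dB u))"
proof (rule sum_mono)
  fix u assume u: "u \<in> V"
  have "danger b D \<tau> (dM' u) (dB u + \<delta> u) \<le> danger b D \<tau> (dM u) (dB u + \<delta> u)"
    using b mono u by (intro danger_antimono)
  also have "\<dots> = danger b D \<tau> (dM u) (dB u)"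
    using safe[OF u] by (auto simp: danger_def)
  finally show "danger b D \<tau> (dM' u) (dB u + \<delta> u) \<le> danger b D \<tau> (dM u) (dB u)" .
qed

lemma potential_bound:
  assumes b: "b \<ge> 1" and fin: "finite V" and v: "v \<in> V" "dM v < D"
    and bound: "(\<Sum>u\<in>V. danger b D \<tau> (dM u) (dB u)) \<le> c"
    and r: "c * 2 ^ D < (4 * real b / (4 * real b - 1)) ^ r"
  shows "dB v < \<tau> + r"
proof (rule ccontr)
  assume "\<not> ?thesis"
  then have "r \<le> dB v - \<tau>" by simp
  define x where "x = 4 * real b / (4 * real b - 1)"
  have x: "x \<ge> 1" using b by (auto simp: x_def field_simps)
  have "x ^ r / 2 ^ D \<le> x ^ (dB v - \<tau>) / 2 ^ dM v"
    using x v(2) \<open>r \<le> dB v - \<tau>\<close> by (intro frac_le power_increasing) auto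
  also have "\<dots> = danger b D \<tau> (dM v) (dB v)" using v(2) by (simp add: danger_def x_def)
  also have "\<dots> \<le> (\<Sum>u\<in>V. danger b D \<tau> (dM u) (dB u))"
    using v fin danger_nonneg[OF b] by (intro member_le_sum) auto
  also have "\<dots> \<le> c" by (rule bound)
  finally have "x ^ r \<le> c * 2 ^ D" by (simp add: divide_le_eq)
  then show False using r by (simp add: x_def)
qed

section \<open>The strategy on a pseudorandom board\<close>

lemma gaps_zero_successively: "gaps M P = 0 \<Longrightarrow> successively (\<lambda>y z. {y, z} \<in> M) P"
  by (induction P) (auto simp: gaps_Cons successively_Cons split: if_splits)

lemma distinct_heads:
  "distinct (concat Ps) \<Longrightarrow> \<forall>P\<in>set Ps. P \<noteq> [] \<Longrightarrow> distinct (map hd Ps)"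
proof (induction Ps)
  case (Cons P Ps)
  have "hd P \<notin> hd ` set Ps"
  proof
    assume "hd P \<in> hd ` set Ps"
    then obtain P' where P': "P' \<in> set Ps" "hd P = hd P'" by auto
    have "P \<noteq> []" "P' \<noteq> []" using Cons.prems P'(1) by auto
    then have "hd P \<in> set P \<inter> set P'" using P'(2) hd_in_set[of P] hd_in_set[of P'] by simp
    moreover have "set P \<inter> set P' = {}" using Cons.prems P'(1) by auto
    ultimately show False by blast
  qed
  then show ?case using Cons by auto
qed simp

text \<open>
  The properties of the board that the strategy relies on. Maker uses \<open>U\<close> as the set of
  pivots and \<open>G\<^sub>1\<close> as the reservoir of edges into \<open>U\<close>. \<open>D\<close>
  is the number of edges into \<open>U\<close> that a vertex needs for expansion, \<open>\<tau>\<close>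
  the loss at which a vertex counts as endangered, and \<open>r\<close> the further loss that the
  potential permits; assumption \<open>D1_big\<close> says that the degree \<open>D\<^sub>1\<close>
  survives all of this. \<open>s\<close> is both the expansion scale and half the number of paths at
  which Maker stops merging, \<open>Q\<close> exceeds what both players can claim in \<open>2 *
  n\<close> rounds, and \<open>N\<close> bounds the number of Maker's moves.
\<close>

locale good_board =
  fixes n b D D\<^sub>1 \<tau> r s Q N :: nat and U :: "nat set" and G G\<^sub>1 :: "nat set set"
  assumes n3: "n \<ge> 3" and b_pos: "b \<ge> 1" and D_pos: "D \<ge> 1"
    and U_sub: "U \<subseteq> {..<n}" and G1_sub: "G\<^sub>1 \<subseteq> G" and G_sub: "G \<subseteq> all_edges n"
    and degree: "\<And>v. v < n \<Longrightarrow> D\<^sub>1 \<le> deg_into U G\<^sub>1 v"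
    and sparse: "\<And>S T. S \<subseteq> {..<n} \<Longrightarrow> T \<subseteq> U \<Longrightarrow> S \<noteq> {} \<Longrightarrow> card S \<le> s \<Longrightarrow>
      card T \<le> 3 * card S \<Longrightarrow> card {(v, x) \<in> S \<times> T. {v, x} \<in> G\<^sub>1} < D * card S"
    and dense: "\<And>A C. A \<subseteq> {..<n} \<Longrightarrow> C \<subseteq> {..<n} \<Longrightarrow> A \<inter> C = {} \<Longrightarrow> s \<le> card A \<Longrightarrow>
      s \<le> card C \<Longrightarrow> Q \<le> card (G \<inter> {{a, c} | a c. a \<in> A \<and> c \<in> C})"
    and rich: "\<And>L H. distinct L \<Longrightarrow> set L = {..<n} \<Longrightarrow> H \<subseteq> all_edges n \<Longrightarrow> card H \<le> 2 * n \<Longrightarrow>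
      s\<^sup>2 \<le> 2 * card (boosters U H L) \<Longrightarrow> Q \<le> card (G \<inter> boosters U H L)"
    and Q_big: "2 * n + b * (2 * n + 1) < Q"
    and D1_big: "\<tau> + r + b + D \<le> D\<^sub>1"
    and r_big: "real n * 2 ^ D < (4 * real b / (4 * real b - 1)) ^ r"
    and N_big: "real n + D * (card U + 4 * s) + 4 * b * n * D / (\<tau> + 1) < real N"
    and N_small: "N \<le> 2 * n"
begin

abbreviation "V \<equiv> {..<n}"

text \<open>
  The function \<open>dM\<close> is applied to Maker's and to Breaker's edges alike. Work is the number
  of useful answers that Maker has given at the vertices in question; it pays for the moves that do not
  remove a gap.
\<close>

definition dM :: "nat set set \<Rightarrow> nat \<Rightarrow> nat" where "dM E v = deg_into U (E \<inter> G\<^sub>1) v"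
definition endangered :: "nat set set \<Rightarrow> nat set" where "endangered B = {v \<in> V. \<tau> < dM B v}"
definition work :: "nat set set \<Rightarrow> nat set \<Rightarrow> nat" where "work M O' = (\<Sum>v\<in>O'. min D (dM M v))"
definition pot :: "nat set set \<Rightarrow> nat set set \<Rightarrow> real" where
  "pot M B = (\<Sum>v\<in>V. danger b D \<tau> (dM M v) (dM B v))"

definition basic :: "nat set set \<Rightarrow> nat set set \<Rightarrow> bool" where
  "basic M B \<longleftrightarrow> M \<subseteq> G \<and> B \<subseteq> G \<and> card B \<le> b * card M \<and> pot M B \<le> n"

text \<open>
  First phase: Maker's paths partition the vertices outside \<open>U\<close>. Every move either merges
  two paths or answers at an endangered vertex, which is what the final inequality counts.
\<close>

definition merging :: "nat set set \<Rightarrow> nat set set \<Rightarrow> nat list list \<Rightarrow> bool" where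
  "merging M B Ps \<longleftrightarrow> (\<forall>P\<in>set Ps. P \<noteq> [] \<and> gaps M P = 0) \<and> distinct (concat Ps) \<and>
     set (concat Ps) = V - U \<and> card M + length Ps \<le> card (V - U) + work M (endangered B)"

text \<open>
  Second phase: \<open>W\<close> collects \<open>U\<close> and the ends of all paths, hence all vertices
  that can become an end of the list. Rotations break pairs that contain a vertex of \<open>U\<close>,
  and cutting a cycle open breaks a gap. As the resulting ends have to lie in \<open>W\<close>, the only
  consecutive pairs allowed to leave \<open>W\<close> are those never broken: edges of Maker that avoid
  \<open>U\<close>.
\<close>

definition sound_pair :: "nat set set \<Rightarrow> nat set \<Rightarrow> nat \<Rightarrow> nat \<Rightarrow> bool" where
  "sound_pair M W y z \<longleftrightarrow> (y \<in> W \<and> z \<in> W) \<or> ({y, z} \<in> M \<and> y \<notin> U \<and> z \<notin> U)"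

definition closing :: "nat set set \<Rightarrow> nat set set \<Rightarrow> nat set \<Rightarrow> nat list \<Rightarrow> bool" where
  "closing M B W L \<longleftrightarrow> distinct L \<and> set L = V \<and> U \<subseteq> W \<and> W \<subseteq> V \<and> card W \<le> card U + 4 * s \<and>
     successively (sound_pair M W) L \<and> hd L \<in> W \<and> last L \<in> W \<and>
     card M + gaps M L \<le> n + work M (W \<union> endangered B)"

definition invariant :: "nat set set \<Rightarrow> nat set set \<Rightarrow> bool" where
  "invariant M B \<longleftrightarrow> basic M B \<and> ((\<exists>Ps. merging M B Ps) \<or> (\<exists>W L. closing M B W L))"

lemma finite_U [simp]: "finite U"
  using U_sub by (rule finite_subset) simp

lemma spanning_nonempty: "set L = V \<Longrightarrow> L \<noteq> []"
  using n3 by (metis card.empty card_lessThan list.set(1) not_numeral_le_zero)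

lemma finite_G [simp]: "finite G"
proof -
  have "G \<subseteq> Pow V" using G_sub by (auto simp: all_edges_def)
  then show ?thesis by (rule finite_subset) simp
qed

lemma dM_mono: "M \<subseteq> M' \<Longrightarrow> dM M v \<le> dM M' v"
  unfolding dM_def by (intro deg_into_mono) auto

lemma endangered_mono: "B \<subseteq> B' \<Longrightarrow> endangered B \<subseteq> endangered B'"
  using dM_mono[of B B'] by (auto simp: endangered_def intro: less_le_trans)

lemma endangered_sub: "endangered B \<subseteq> V"
  by (auto simp: endangered_def)

lemma finite_endangered [simp]: "finite (endangered B)"
  using endangered_sub by (rule finite_subset) simp

lemma work_mono:
  assumes "M \<subseteq> M'" "A \<subseteq> A'" "finite A'"
  shows "work M A \<le> work M' A'"
proof -
  have "work M A \<le> work M' A"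
    unfolding work_def using dM_mono[OF assms(1)] by (intro sum_mono min.mono) auto
  also have "\<dots> \<le> work M' A'"
    unfolding work_def using assms by (intro sum_mono2) auto
  finally show ?thesis .
qed

lemma work_answer:
  assumes "v \<in> A" "dM M v < D" "dM M v < dM M' v" "M \<subseteq> M'" "A \<subseteq> A'" "finite A'"
  shows "Suc (work M A) \<le> work M' A'"
proof -
  have fin: "finite A" using assms finite_subset by auto
  have "Suc (work M A) = Suc (min D (dM M v)) + work M (A - {v})"
    unfolding work_def using fin assms(1) by (simp add: sum.remove)
  also have "\<dots> \<le> min D (dM M' v) + work M' (A - {v})"
    using assms fin by (intro add_mono work_mono) auto
  also have "\<dots> = work M' A"
    unfolding work_def using fin assms(1) by (simp add: sum.remove)
  also have "\<dots> \<le> work M' A'" using assms by (intro work_mono) auto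
  finally show ?thesis .
qed

lemma work_le: "finite A \<Longrightarrow> work M A \<le> D * card A"
  unfolding work_def using sum_bounded_above[of A "\<lambda>v. min D (dM M v)" D] by (simp add: mult.commute)

lemma card_endangered:
  assumes "B \<subseteq> G"
  shows "card (endangered B) * (\<tau> + 1) \<le> 2 * card B"
proof -
  have "card (endangered B) * (\<tau> + 1) \<le> (\<Sum>v\<in>endangered B. dM B v)"
    using sum_bounded_below[of "endangered B" "\<tau> + 1" "dM B"] by (auto simp: endangered_def)
  also have "\<dots> \<le> 2 * card (B \<inter> G\<^sub>1)"
    unfolding dM_def using assms finite_subset[OF assms finite_G] by (intro sum_deg_into_le) auto
  also have "\<dots> \<le> 2 * card B"
    using finite_subset[OF assms finite_G] by (intro mult_left_mono card_mono) auto
  finally show ?thesis .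
qed

text \<open>
  Maker's moves number at most \<open>n\<close> plus the work, and the work is at most \<open>D\<close>
  for each vertex of \<open>W\<close> and each endangered vertex. As Breaker endangers at most \<open>2
  * b * card M / (\<tau> + 1)\<close> vertices, this is an inequality \<open>card M \<le> c + \<theta> *
  card M\<close>; since \<open>\<theta> < 1\<close>, it first gives \<open>card M \<le> 2 * n\<close>
  and then, inserted on the right-hand side, the claimed bound.
\<close>

lemma invariant_bound:
  assumes "invariant M B"
  shows "card M < N"
proof -
  define d where "d = card (endangered B)"
  have basic: "basic M B" using assms by (simp add: invariant_def)
  have fin: "finite M" using basic finite_subset[OF _ finite_G] by (auto simp: basic_def)
  have "card M \<le> n + D * (card U + 4 * s + d)"
  proof (cases "\<exists>W L. closing M B W L")
    case True
    then obtain W L where c: "closing M B W L" by auto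
    have fW: "finite W" using c finite_subset[of W V] by (auto simp: closing_def)
    have "card M \<le> n + work M (W \<union> endangered B)" using c by (simp add: closing_def)
    also have "\<dots> \<le> n + D * card (W \<union> endangered B)" using fW by (intro add_left_mono work_le) auto
    also have "\<dots> \<le> n + D * (card W + d)"
      unfolding d_def by (intro add_left_mono mult_left_mono card_Un_le) auto
    also have "\<dots> \<le> n + D * (card U + 4 * s + d)"
      using c by (intro add_left_mono mult_left_mono) (auto simp: closing_def)
    finally show ?thesis .
  next
    case False
    then obtain Ps where c: "merging M B Ps" using assms by (auto simp: invariant_def)
    have "card M \<le> card (V - U) + work M (endangered B)" using c by (simp add: merging_def)
    also have "\<dots> \<le> n + D * d"
      unfolding d_def using card_mono[of V "V - U"] by (intro add_mono work_le) auto
    also have "\<dots> \<le> n + D * (card U + 4 * s + d)" by simp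
    finally show ?thesis .
  qed
  then have m: "real (card M) \<le> real n + D * (card U + 4 * s) + D * d"
    by (simp add: algebra_simps flip: of_nat_add of_nat_mult)
  have "d * (\<tau> + 1) \<le> 2 * (b * card M)"
    using card_endangered[of B] basic by (auto simp: d_def basic_def)
  then have "real d * (\<tau> + 1) \<le> 2 * b * card M"
    by (metis (mono_tags, lifting) of_nat_le_iff of_nat_mult mult.assoc of_nat_numeral of_nat_add of_nat_1)
  then have d: "real d \<le> 2 * b * card M / (\<tau> + 1)"
    by (simp add: pos_le_divide_eq)
  define c where "c = real n + D * (card U + 4 * s)"
  define \<theta> where "\<theta> = 2 * real b * D / (\<tau> + 1)"
  have "real D * d \<le> D * (2 * b * card M / (\<tau> + 1))" using d by (intro mult_left_mono) auto
  then have m1: "real (card M) \<le> c + \<theta> * card M"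
    using m by (simp add: c_def \<theta>_def mult_ac)
  have N: "c + \<theta> * (2 * n) < N"
    using N_big by (simp add: c_def \<theta>_def mult_ac)
  have c0: "0 \<le> c" "0 \<le> \<theta>" by (simp_all add: c_def \<theta>_def)
  have "card M \<le> 2 * n"
  proof (rule ccontr)
    assume "\<not> ?thesis"
    then have big: "real (2 * n) < card M" by (simp flip: of_nat_mult)
    have "c + \<theta> * (2 * n) < 2 * n" using N N_small by linarith
    then have "\<theta> * (2 * n) < 1 * (2 * real n)" using c0 by simp
    then have "\<theta> < 1" using n3 by (simp add: mult_less_cancel_right)
    then have "(1 - \<theta>) * (2 * n) < (1 - \<theta>) * card M"
      using big by (intro mult_strict_left_mono) auto
    then show False using m1 \<open>c + \<theta> * (2 * n) < 2 * n\<close> by (simp add: algebra_simps)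
  qed
  then have "\<theta> * card M \<le> \<theta> * (2 * n)" using c0 by (intro mult_left_mono) auto
  then show ?thesis using m1 N by linarith
qed

lemma invariant_init: "invariant {} {}"
proof -
  have zero: "dM {} v = 0" for v by (simp add: dM_def deg_into_def)
  have "basic {} {}"
    using D_pos by (simp add: basic_def pot_def zero danger_def)
  moreover have "merging {} {} (map (\<lambda>v. [v]) (sorted_list_of_set (V - U)))"
    by (simp add: merging_def comp_def)
  ultimately show ?thesis by (auto simp: invariant_def)
qed

lemma sound_pair_sym: "sound_pair M W y z \<Longrightarrow> sound_pair M W z y"
  by (auto simp: sound_pair_def insert_commute)

text \<open>Gaps arise only where one path ends and the next begins, and at the vertices of \<open>us\<close>.\<close>

lemma concatenation_sound:
  assumes "\<forall>P\<in>set Ps. P \<noteq> [] \<and> gaps M P = 0 \<and> set P \<inter> U = {} \<and> hd P \<in> W \<and> last P \<in> W"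
    and "set us \<subseteq> W"
  shows "successively (sound_pair M W) (concat Ps @ us) \<and>
     gaps M (concat Ps @ us) \<le> length Ps + length us \<and>
     (concat Ps @ us \<noteq> [] \<longrightarrow> hd (concat Ps @ us) \<in> W \<and> last (concat Ps @ us) \<in> W)"
  using assms(1)
proof (induction Ps)
  case Nil
  have "successively (sound_pair M W) us"
    using assms(2)
    by (induction us) (auto simp: successively_Cons sound_pair_def dest: subsetD[OF _ hd_in_set])
  then show ?case using assms(2) by (auto simp: gaps_le_length)
next
  case (Cons P Ps)
  have P: "P \<noteq> []" "gaps M P = 0" "set P \<inter> U = {}" "hd P \<in> W" "last P \<in> W"
    using Cons.prems by auto
  have "successively (\<lambda>y z. {y, z} \<in> M) P" using P(2) by (rule gaps_zero_successively)
  then have "successively (sound_pair M W) P"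
    by (rule successively_mono) (use P(3) in \<open>auto simp: sound_pair_def\<close>)
  moreover define R where "R = concat Ps @ us"
  moreover have "\<forall>P\<in>set Ps. P \<noteq> [] \<and> gaps M P = 0 \<and> set P \<inter> U = {} \<and> hd P \<in> W \<and> last P \<in> W"
    using Cons.prems by simp
  then have "successively (sound_pair M W) R" "gaps M R \<le> length Ps + length us"
    "R \<noteq> [] \<Longrightarrow> hd R \<in> W \<and> last R \<in> W"
    using Cons.IH unfolding R_def by blast+
  ultimately have "successively (sound_pair M W) (P @ R) \<and> gaps M (P @ R) \<le> Suc (length Ps) + length us \<and>
      hd (P @ R) \<in> W \<and> last (P @ R) \<in> W"
    using P(1,2,4,5)
    by (cases "R = []") (simp_all add: successively_append_iff gaps_append sound_pair_def)
  then show ?case by (simp add: R_def)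
qed

text \<open>
  With fewer than \<open>2 * s\<close> paths left, Maker strings them together and appends the vertices
  of \<open>U\<close> as a list full of gaps.
\<close>

lemma merging_imp_closing:
  assumes Ps: "merging M B Ps" and short: "length Ps < 2 * s"
  shows "\<exists>W L. closing M B W L"
proof -
  define us where "us = sorted_list_of_set U"
  define W where "W = U \<union> (hd ` set Ps \<union> last ` set Ps)"
  define L where "L = concat Ps @ us"
  have us: "set us = U" "distinct us" "length us = card U" by (auto simp: us_def)
  have paths: "\<forall>P\<in>set Ps. P \<noteq> [] \<and> gaps M P = 0" "distinct (concat Ps)" "set (concat Ps) = V - U"
    using Ps by (auto simp: merging_def)
  have L: "set L = V" "distinct L" using paths us U_sub by (auto simp: L_def)
  then have "L \<noteq> []" by (intro spanning_nonempty)
  have "\<forall>P\<in>set Ps. P \<noteq> [] \<and> gaps M P = 0 \<and> set P \<inter> U = {} \<and> hd P \<in> W \<and> last P \<in> W"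
    using paths by (auto simp: W_def)
  from concatenation_sound[OF this, of us] us
  have sound: "successively (sound_pair M W) L" "gaps M L \<le> length Ps + card U"
    "hd L \<in> W" "last L \<in> W"
    using \<open>L \<noteq> []\<close> by (auto simp: L_def W_def)
  have "hd P \<in> V \<and> last P \<in> V" if "P \<in> set Ps" for P
  proof -
    have "{hd P, last P} \<subseteq> set (concat Ps)"
      using that paths(1) hd_in_set[of P] last_in_set[of P] by (auto intro!: bexI[of _ P])
    then show ?thesis unfolding paths(3) by simp
  qed
  then have "W \<subseteq> V" using U_sub by (auto simp: W_def)
  have "card W \<le> card U + (card (hd ` set Ps) + card (last ` set Ps))"
    unfolding W_def by (rule order_trans[OF card_Un_le add_left_mono[OF card_Un_le]])
  also have "\<dots> \<le> card U + (length Ps + length Ps)"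
    by (intro add_mono order_refl order_trans[OF card_image_le card_length]) auto
  also have "\<dots> \<le> card U + 4 * s" using short by simp
  finally have "card W \<le> card U + 4 * s" .
  moreover have "card M + gaps M L \<le> n + work M (W \<union> endangered B)"
  proof -
    have "card M + gaps M L \<le> card (V - U) + work M (endangered B) + card U"
      using Ps sound(2) by (simp add: merging_def)
    also have "card (V - U) + card U = n"
      using U_sub by (simp add: card_Diff_subset card_mono[of V U, simplified])
    then have "card (V - U) + work M (endangered B) + card U = n + work M (endangered B)" by simp
    also have "work M (endangered B) \<le> work M (W \<union> endangered B)"
      using \<open>W \<subseteq> V\<close> finite_subset[of W V] by (intro work_mono) auto
    finally show ?thesis by simp
  qed
  ultimately have "closing M B W L"
    using L sound \<open>W \<subseteq> V\<close> by (auto simp: closing_def W_def)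
  then show ?thesis by blast
qed

text \<open>
  Both ends of every rotated list lie in \<open>W\<close>, so the expansion of \<open>W\<close> into
  \<open>U\<close> applies to each end in turn: more than \<open>s\<close> heads, and for each of them
  more than \<open>s\<close> partners.
\<close>

lemma closing_many_boosters:
  assumes c: "closing M B W L" and full: "\<forall>v\<in>W. D \<le> dM M v"
  shows "s\<^sup>2 \<le> 2 * card (boosters U (M \<inter> G\<^sub>1) L)"
    and "\<And>L\<^sub>1. L\<^sub>1 \<in> rotations U (M \<inter> G\<^sub>1) L \<Longrightarrow> successively (sound_pair M W) L\<^sub>1 \<and> hd L\<^sub>1 \<in> W"
    and "\<And>L\<^sub>1 L\<^sub>2. L\<^sub>1 \<in> rotations U (M \<inter> G\<^sub>1) L \<Longrightarrow> L\<^sub>2 \<in> rotations U (M \<inter> G\<^sub>1) (rev L\<^sub>1) \<Longrightarrow>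
      successively (sound_pair M W) L\<^sub>2 \<and> hd L\<^sub>2 \<in> W"
proof -
  let ?H = "M \<inter> G\<^sub>1"
  have W: "U \<subseteq> W" "W \<subseteq> V" "finite W"
    using c finite_subset[of W V] by (auto simp: closing_def)
  have rot: "successively (sound_pair M W) L'' \<and> hd L'' \<in> W"
    if "L'' \<in> rotations U ?H L'" "successively (sound_pair M W) L'" "hd L' \<in> W" for L' L''
    using that(1,2)
  proof (rule rotations_successively)
    show "sound_pair M W z y" if "sound_pair M W y z" for y z using that by (rule sound_pair_sym)
    show "y \<in> W" if "sound_pair M W y x" "x \<in> U" for y x using that by (auto simp: sound_pair_def)
    show "sound_pair M W y x" if "y \<in> W" "x \<in> U" for y x
      using that W by (auto simp: sound_pair_def)
    show "hd L' \<in> W" by (rule that)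
  qed
  have heads: "s < card (hd ` rotations U ?H L')"
    if L': "distinct L'" "set L' = V" "successively (sound_pair M W) L'" "hd L' \<in> W" for L'
  proof (rule many_rotation_heads[where W = W and D = D])
    show "hd ` rotations U ?H L' \<subseteq> W" using rot L' by auto
    show "D \<le> deg_into U ?H v" if "v \<in> W" for v using full that by (simp add: dM_def)
    fix S T assume "S \<subseteq> W" "T \<subseteq> U" "S \<noteq> {}" "card S \<le> s" "card T \<le> 3 * card S"
    then have "card {(v, x) \<in> S \<times> T. {v, x} \<in> G\<^sub>1} < D * card S" using W by (intro sparse) auto
    moreover have "finite (S \<times> T)"
      using \<open>S \<subseteq> W\<close> \<open>T \<subseteq> U\<close> W finite_subset[of S W] finite_subset[of T U] by auto
    then have "card {(v, x) \<in> S \<times> T. {v, x} \<in> ?H} \<le> card {(v, x) \<in> S \<times> T. {v, x} \<in> G\<^sub>1}"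
      by (intro card_mono) (auto elim: finite_subset[rotated])
    ultimately show "card {(v, x) \<in> S \<times> T. {v, x} \<in> ?H} < D * card S" by simp
  qed (use L' U_sub W in auto)
  have L: "distinct L" "set L = V" "successively (sound_pair M W) L" "hd L \<in> W" "last L \<in> W"
    using c by (auto simp: closing_def)
  show rot1: "successively (sound_pair M W) L\<^sub>1 \<and> hd L\<^sub>1 \<in> W" if "L\<^sub>1 \<in> rotations U ?H L" for L\<^sub>1
    using that L by (intro rot)
  have rev1: "successively (sound_pair M W) (rev L\<^sub>1) \<and> hd (rev L\<^sub>1) \<in> W"
    if "L\<^sub>1 \<in> rotations U ?H L" for L\<^sub>1
  proof -
    have "successively (sound_pair M W) L\<^sub>1" using rot1[OF that] by simp
    then have "successively (\<lambda>y z. sound_pair M W z y) L\<^sub>1"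
      by (rule successively_mono) (rule sound_pair_sym)
    moreover have "hd (rev L\<^sub>1) = last L"
      using rotations_same_set[OF that] by (simp add: hd_rev)
    ultimately show ?thesis using L by simp
  qed
  then show "successively (sound_pair M W) L\<^sub>2 \<and> hd L\<^sub>2 \<in> W"
    if "L\<^sub>1 \<in> rotations U ?H L" "L\<^sub>2 \<in> rotations U ?H (rev L\<^sub>1)" for L\<^sub>1 L\<^sub>2
    using that by (intro rot[of L\<^sub>2 "rev L\<^sub>1"]) auto
  show "s\<^sup>2 \<le> 2 * card (boosters U ?H L)"
  proof (rule many_boosters)
    show "L \<noteq> []" using L(2) by (rule spanning_nonempty)
    show "s \<le> card (hd ` rotations U ?H L)" using heads[OF L(1-4)] by simp
    show "s \<le> card (hd ` rotations U ?H (rev L'))" if "L' \<in> rotations U ?H L" for L'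
      using heads[of "rev L'"] rev1[OF that] rotations_same_set[OF that] rotations_distinct[OF that] L
      by (simp add: less_imp_le)
  qed
qed

text \<open>One round, in which Breaker claims \<open>S\<close> in the position given by \<open>M\<close> and \<open>B\<close>.\<close>

context
  fixes M B S :: "nat set set"
  assumes inv: "invariant M B" and S: "S \<subseteq> G - (M \<union> B)" and card_S: "card S \<le> b"
begin

lemma basics: "M \<subseteq> G" "B \<subseteq> G" "card B \<le> b * card M" "pot M B \<le> n" "finite M" "finite B" "finite S"
proof -
  show "M \<subseteq> G" "B \<subseteq> G" "card B \<le> b * card M" "pot M B \<le> n"
    using inv by (auto simp: invariant_def basic_def)
  then show "finite M" "finite B" by (auto intro: finite_subset)
  show "finite S" using S by (intro finite_subset[of S G]) auto
qed

lemma round_bounds: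
  shows "card (B \<union> S) \<le> b * Suc (card M)" and "card (M \<union> B \<union> S) < Q" and "card M \<le> 2 * n"
proof -
  show 1: "card (B \<union> S) \<le> b * Suc (card M)"
    using card_Un_le[of B S] basics card_S by simp
  show 2: "card M \<le> 2 * n" using invariant_bound[OF inv] N_small by simp
  have "card (M \<union> B \<union> S) \<le> card M + card (B \<union> S)"
    using card_Un_le[of M "B \<union> S"] by (simp add: Un_assoc)
  also have "\<dots> \<le> 2 * n + b * (2 * n + 1)"
    using 1 2 by (intro add_mono order_trans[OF 1] mult_left_mono) auto
  also have "\<dots> < Q" by (rule Q_big)
  finally show "card (M \<union> B \<union> S) < Q" .
qed

lemma free_edge_in:
  assumes "Q \<le> card (G \<inter> T)"
  obtains e where "e \<in> T" "e \<in> G - (M \<union> B \<union> S)"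
proof -
  have "\<not> G \<inter> T \<subseteq> M \<union> B \<union> S"
  proof
    assume "G \<inter> T \<subseteq> M \<union> B \<union> S"
    then have "card (G \<inter> T) \<le> card (M \<union> B \<union> S)" using basics by (intro card_mono) auto
    then show False using assms round_bounds(2) by simp
  qed
  then show ?thesis using that by auto
qed

lemma free_link:
  assumes v: "v \<in> V" "dM M v < D"
  obtains x where "x \<in> U" "{v, x} \<in> G\<^sub>1" "{v, x} \<notin> M \<union> B \<union> S"
proof -
  let ?F = "G\<^sub>1 - (M \<union> B \<union> S)"
  have dB: "dM B v < \<tau> + r"
    by (rule potential_bound[where V = V and dM = "dM M" and dB = "dM B", OF b_pos _ v])
       (use basics(4) r_big in \<open>auto simp: pot_def\<close>)
  have "D\<^sub>1 \<le> deg_into U (?F \<union> (M \<inter> G\<^sub>1 \<union> (B \<inter> G\<^sub>1 \<union> S))) v"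
    using degree[of v] v by (intro order_trans[OF degree deg_into_mono]) auto
  also have "\<dots> \<le> deg_into U ?F v + (dM M v + (dM B v + deg_into U S v))"
    unfolding dM_def
    by (intro order_trans[OF deg_into_Un_le] add_left_mono) (auto intro: order_trans[OF deg_into_Un_le])
  also have "deg_into U S v \<le> b" using deg_into_le_card[OF basics(7)] card_S order_trans by blast
  finally have "deg_into U ?F v > 0" using D1_big dB v(2) by linarith
  then have "{x \<in> U. {v, x} \<in> ?F} \<noteq> {}" by (metis card.empty deg_into_def less_irrefl)
  then show ?thesis using that by blast
qed

lemma pot_round_idle:
  assumes "\<And>u. u \<in> endangered (B \<union> S) \<Longrightarrow> D \<le> dM M u" and "M \<subseteq> M'"
  shows "pot M' (B \<union> S) \<le> n"
proof -
  define \<delta> where "\<delta> u = dM (B \<union> S) u - dM B u" for u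
  have \<delta>: "dM (B \<union> S) u = dM B u + \<delta> u" for u
    using dM_mono[of B "B \<union> S" u] by (simp add: \<delta>_def)
  have "pot M' (B \<union> S) \<le> pot M B"
    unfolding pot_def \<delta>
  proof (rule potential_idle[OF b_pos])
    fix u assume "u \<in> V" "dM M u < D"
    then have "u \<notin> endangered (B \<union> S)" using assms(1) by fastforce
    then show "dM B u + \<delta> u \<le> \<tau>" using \<open>u \<in> V\<close> by (simp add: endangered_def flip: \<delta>)
  qed (use dM_mono[OF assms(2)] in auto)
  then show ?thesis using basics by simp
qed

text \<open>
  If some endangered vertex is needy, the answer must be at one of largest weight to keep the potential
  down; otherwise any needy vertex will do.
\<close>

lemma answer:
  assumes A: "endangered (B \<union> S) \<subseteq> A" "A \<subseteq> V" and needy: "u \<in> A" "dM M u < D"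
  obtains v x where "v \<in> A" "dM M v < D" "x \<in> U" "{v, x} \<in> G\<^sub>1" "{v, x} \<notin> M \<union> B \<union> S"
    "dM M v < dM (insert {v, x} M) v" "pot (insert {v, x} M) (B \<union> S) \<le> n"
proof -
  have gain: "dM M v < dM (insert {v, x} M) v" if "x \<in> U" "{v, x} \<in> G\<^sub>1" "{v, x} \<notin> M" for v x
    using deg_into_insert_new[of U x v "M \<inter> G\<^sub>1"] that by (simp add: dM_def)
  define Act where "Act = {v \<in> endangered (B \<union> S). dM M v < D}"
  show ?thesis
  proof (cases "Act = {}")
    case True
    obtain x where x: "x \<in> U" "{u, x} \<in> G\<^sub>1" "{u, x} \<notin> M \<union> B \<union> S"
      using free_link[of u] needy A by auto
    have "pot (insert {u, x} M) (B \<union> S) \<le> n"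
      using True by (intro pot_round_idle) (auto simp: Act_def not_less)
    then show ?thesis using that[OF needy x] gain x by auto
  next
    case False
    define w where "w v = danger b D \<tau> (dM M v) (dM (B \<union> S) v)" for v
    have "finite Act" by (simp add: Act_def)
    then obtain v where v: "v \<in> Act" "\<And>v'. v' \<in> Act \<Longrightarrow> w v' \<le> w v"
      using False obtains_MAX[of Act w] by (metis Max_ge finite_imageI imageI)
    then have vD: "v \<in> V" "dM M v < D" "v \<in> A" using A by (auto simp: Act_def)
    obtain x where x: "x \<in> U" "{v, x} \<in> G\<^sub>1" "{v, x} \<notin> M \<union> B \<union> S"
      using free_link[OF vD(1,2)] by auto
    have up: "dM M v < dM (insert {v, x} M) v" using gain x by auto
    define \<delta> where "\<delta> u = dM (B \<union> S) u - dM B u" for u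
    have \<delta>: "dM (B \<union> S) u = dM B u + \<delta> u" for u
      using dM_mono[of B "B \<union> S" u] by (simp add: \<delta>_def)
    have "\<delta> u \<le> deg_into U (S \<inter> G\<^sub>1) u" for u
      using deg_into_Un_le[of U "B \<inter> G\<^sub>1" "S \<inter> G\<^sub>1" u] by (simp add: \<delta>_def dM_def Int_Un_distrib2)
    then have "(\<Sum>u\<in>V. \<delta> u) \<le> (\<Sum>u\<in>V. deg_into U (S \<inter> G\<^sub>1) u)" by (intro sum_mono)
    also have "\<dots> \<le> 2 * card (S \<inter> G\<^sub>1)" using basics by (intro sum_deg_into_le) auto
    also have "\<dots> \<le> 2 * card S" using basics by (intro mult_left_mono card_mono) auto
    finally have total: "(\<Sum>u\<in>V. \<delta> u) \<le> 2 * b" using card_S by simp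
    have "pot (insert {v, x} M) (B \<union> S) \<le> pot M B"
      unfolding pot_def \<delta>
    proof (rule potential_step[where v = v and \<delta> = \<delta> and dM = "dM M" and dM' = "dM (insert {v, x} M)", OF b_pos _ vD(1) total _ _ up])
      fix u assume u: "u \<in> V" "\<tau> < dM B u + \<delta> u"
      show "danger b D \<tau> (dM M u) (dM B u + \<delta> u) \<le> danger b D \<tau> (dM M v) (dM B v + \<delta> v)"
      proof (cases "dM M u < D")
        case True
        then have "u \<in> Act" using u by (simp add: Act_def endangered_def \<delta>)
        then show ?thesis using v(2)[of u] by (simp add: w_def \<delta>)
      next
        case False
        then show ?thesis using danger_nonneg[OF b_pos] by (simp add: danger_def[of b D \<tau> "dM M u"])
      qed
    qed (auto intro: dM_mono)
    then show ?thesis using that[OF vD(3,2) x up] basics by simp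
  qed
qed

lemma basic_round:
  assumes "e \<in> G - (M \<union> B \<union> S)" and "pot (insert e M) (B \<union> S) \<le> n"
  shows "basic (insert e M) (B \<union> S)"
  using assms basics S round_bounds(1) by (auto simp: basic_def)

text \<open>
  When no endangered vertex asks for an answer, the heads of the first \<open>s\<close> paths and those
  of the others are two large disjoint sets, between which \<open>G\<close> has a free edge.
\<close>

lemma merging_step:
  assumes Ps: "merging M B Ps" and long: "2 * s \<le> length Ps"
  shows "\<exists>e \<in> G - (M \<union> B \<union> S). invariant (insert e M) (B \<union> S)"
proof (cases "\<exists>u \<in> endangered (B \<union> S). dM M u < D")
  case True
  then obtain u where u: "u \<in> endangered (B \<union> S)" "dM M u < D" by auto
  obtain v x where v: "v \<in> endangered (B \<union> S)" "dM M v < D"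
    and x: "{v, x} \<in> G\<^sub>1" "{v, x} \<notin> M \<union> B \<union> S"
    and up: "dM M v < dM (insert {v, x} M) v" and pot: "pot (insert {v, x} M) (B \<union> S) \<le> n"
    by (rule answer[OF order_refl endangered_sub u])
  have e: "{v, x} \<in> G - (M \<union> B \<union> S)" using x G1_sub by auto
  have "work M (endangered B) \<le> work M (endangered (B \<union> S))"
    by (intro work_mono endangered_mono) auto
  also have "Suc \<dots> \<le> work (insert {v, x} M) (endangered (B \<union> S))"
    using v up by (intro work_answer) auto
  finally have "Suc (work M (endangered B)) \<le> work (insert {v, x} M) (endangered (B \<union> S))" by simp
  moreover have "gaps (insert {v, x} M) P = 0" if "gaps M P = 0" for P
    using gaps_mono[of M "insert {v, x} M" P] that by auto
  ultimately have "merging (insert {v, x} M) (B \<union> S) Ps"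
    using Ps e basics by (auto simp: merging_def)
  then show ?thesis using basic_round[OF e pot] e by (auto simp: invariant_def)
next
  case False
  define A C where "A = hd ` set (take s Ps)" and "C = hd ` set (drop s Ps)"
  have ne: "\<forall>P\<in>set Ps. P \<noteq> []" and dist: "distinct (concat Ps)"
    and cover: "set (concat Ps) = V - U" using Ps by (auto simp: merging_def)
  have heads: "distinct (map hd Ps)" using dist ne by (rule distinct_heads)
  have split: "map hd Ps = map hd (take s Ps) @ map hd (drop s Ps)"
    by (metis append_take_drop_id map_append)
  have "card A = s"
    using heads long split distinct_card[of "map hd (take s Ps)"] by (auto simp: A_def)
  moreover have "card C \<ge> s"
    using heads long split distinct_card[of "map hd (drop s Ps)"] by (auto simp: C_def)
  moreover have "A \<inter> C = {}" using heads split by (auto simp: A_def C_def)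
  moreover have "hd P \<in> V" if "P \<in> set Ps" for P
  proof -
    have "hd P \<in> set (concat Ps)" using that ne hd_in_set[of P] by (auto intro!: bexI[of _ P])
    then show ?thesis unfolding cover by simp
  qed
  then have "A \<subseteq> V" "C \<subseteq> V"
    using in_set_takeD[of _ s Ps] in_set_dropD[of _ s Ps] by (auto simp: A_def C_def)
  ultimately have "Q \<le> card (G \<inter> {{a, c} | a c. a \<in> A \<and> c \<in> C})" by (intro dense) auto
  then obtain e where "e \<in> {{a, c} | a c. a \<in> A \<and> c \<in> C}" and e: "e \<in> G - (M \<union> B \<union> S)"
    by (rule free_edge_in)
  then obtain P P' where P: "P \<in> set (take s Ps)" "P' \<in> set (drop s Ps)" "e = {hd P, hd P'}"
    by (auto simp: A_def C_def)
  obtain Ps1 Ps2 where 1: "take s Ps = Ps1 @ P # Ps2" using P(1) by (meson split_list)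
  obtain Ps3 Ps4 where 2: "drop s Ps = Ps3 @ P' # Ps4" using P(2) by (meson split_list)
  have Ps_eq: "Ps = Ps1 @ P # Ps2 @ Ps3 @ P' # Ps4"
    using append_take_drop_id[of s Ps] 1 2 by simp
  \<comment> \<open>The new edge joins two heads, so one of the paths has to be reversed.\<close>
  define Qs where "Qs = (rev P @ P') # Ps1 @ Ps2 @ Ps3 @ Ps4"
  let ?M = "insert e M"
  have zero: "gaps ?M R = 0" if "gaps M R = 0" for R
    using gaps_mono[of M ?M R] that by auto
  have "gaps ?M (rev P @ P') = 0"
    using Ps P(3) zero by (auto simp: gaps_append merging_def last_rev Ps_eq)
  then have "\<forall>R\<in>set Qs. R \<noteq> [] \<and> gaps ?M R = 0"
    using Ps zero by (auto simp: Qs_def merging_def Ps_eq)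
  moreover have "distinct (concat Qs)" using dist by (auto simp: Qs_def Ps_eq)
  moreover have "set (concat Qs) = V - U" unfolding cover[symmetric] by (auto simp: Qs_def Ps_eq)
  moreover have "card ?M + length Qs \<le> card (V - U) + work ?M (endangered (B \<union> S))"
  proof -
    have "work M (endangered B) \<le> work ?M (endangered (B \<union> S))"
      by (intro work_mono endangered_mono) auto
    moreover have "card ?M + length Qs = card M + length Ps"
      using e basics by (simp add: Qs_def Ps_eq)
    ultimately show ?thesis using Ps by (simp add: merging_def)
  qed
  ultimately have "merging ?M (B \<union> S) Qs" by (simp add: merging_def)
  moreover have "pot ?M (B \<union> S) \<le> n" using False by (intro pot_round_idle) (auto simp: not_less)
  ultimately show ?thesis using basic_round[OF e] e by (auto simp: invariant_def)
qed

text \<open>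
  Maker first answers until all vertices of \<open>W\<close> and all endangered ones have
  \<open>D\<close> edges into \<open>U\<close>. After that a free booster closes a rotated list to a
  cycle: either this is a Hamilton cycle, or the cycle is cut open at one of its gaps, which lie within
  \<open>W\<close>.
\<close>

lemma closing_step:
  assumes c: "closing M B W L"
  shows "\<exists>e \<in> G - (M \<union> B \<union> S). invariant (insert e M) (B \<union> S) \<or>
    (\<exists>F \<in> hamilton_cycles n G. F \<subseteq> insert e M)"
proof (cases "\<exists>u \<in> W \<union> endangered (B \<union> S). dM M u < D")
  case True
  let ?A = "W \<union> endangered (B \<union> S)"
  obtain u where u: "u \<in> ?A" "dM M u < D" using True by auto
  have W: "W \<subseteq> V" "finite W" using c finite_subset[of W V] by (auto simp: closing_def)
  then have "endangered (B \<union> S) \<subseteq> ?A" "?A \<subseteq> V" using endangered_sub by auto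
  then obtain v x where v: "v \<in> ?A" "dM M v < D"
    and x: "{v, x} \<in> G\<^sub>1" "{v, x} \<notin> M \<union> B \<union> S"
    and up: "dM M v < dM (insert {v, x} M) v" and pot: "pot (insert {v, x} M) (B \<union> S) \<le> n"
    using u by (rule answer)
  let ?M = "insert {v, x} M"
  have e: "{v, x} \<in> G - (M \<union> B \<union> S)" using x G1_sub by auto
  have "work M (W \<union> endangered B) \<le> work M ?A"
    using W endangered_mono[of B "B \<union> S"] by (intro work_mono) auto
  also have "Suc \<dots> \<le> work ?M ?A"
    using v up W by (intro work_answer) auto
  finally have "Suc (work M (W \<union> endangered B)) \<le> work ?M ?A" by simp
  moreover have "gaps ?M L \<le> gaps M L" by (rule gaps_mono) auto
  moreover have "successively (sound_pair ?M W) L"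
    using c unfolding closing_def by (auto simp: sound_pair_def elim!: successively_mono)
  ultimately have "closing ?M (B \<union> S) W L"
    using c e basics by (auto simp: closing_def)
  then show ?thesis using basic_round[OF e pot] e by (auto simp: invariant_def)
next
  case False
  let ?H = "M \<inter> G\<^sub>1"
  have W: "W \<subseteq> V" "finite W" using c finite_subset[of W V] by (auto simp: closing_def)
  have L: "distinct L" "set L = V" using c by (auto simp: closing_def)
  have full: "\<forall>v\<in>W. D \<le> dM M v" using False by (auto simp: not_less)
  note cb = closing_many_boosters[OF c full]
  have "Q \<le> card (G \<inter> boosters U ?H L)"
  proof (rule rich[OF L _ _ cb(1)])
    show "?H \<subseteq> all_edges n" using basics G_sub by auto
    show "card ?H \<le> 2 * n"
      using card_mono[of M ?H] basics round_bounds(3) by auto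
  qed
  then obtain e where "e \<in> boosters U ?H L" and e: "e \<in> G - (M \<union> B \<union> S)" by (rule free_edge_in)
  then obtain L\<^sub>1 L\<^sub>2 where L1: "L\<^sub>1 \<in> rotations U ?H L" and L2: "L\<^sub>2 \<in> rotations U ?H (rev L\<^sub>1)"
    and e_eq: "e = {hd L\<^sub>2, last L\<^sub>2}" by (auto simp: boosters_def)
  let ?M = "insert e M"
  have dist: "distinct L\<^sub>2" "set L\<^sub>2 = V"
    using rotations_same_set[OF L1] rotations_same_set[OF L2] L
      rotations_distinct[OF L1] rotations_distinct[OF L2] by auto
  have len: "length L\<^sub>2 = n" using distinct_card[OF dist(1)] dist(2) by simp
  have "L\<^sub>2 \<noteq> []" using dist(2) by (rule spanning_nonempty)
  have "last L\<^sub>2 = hd L\<^sub>1" using rotations_same_set[OF L2] by (simp add: last_rev)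
  then have ends: "hd L\<^sub>2 \<in> W" "last L\<^sub>2 \<in> W" using cb(2)[OF L1] cb(3)[OF L1 L2] by auto
  have gaps: "gaps M L\<^sub>2 \<le> gaps M L"
    using rotations_gaps[OF L1, of M] rotations_gaps[OF L2, of M] by simp
  show ?thesis
  proof (cases "gaps M L\<^sub>2 = 0")
    case True
    have "cycle_edges L\<^sub>2 \<subseteq> ?M"
    proof
      fix f assume "f \<in> cycle_edges L\<^sub>2"
      then obtain i where i: "i < n" and f: "f = {L\<^sub>2 ! i, L\<^sub>2 ! (Suc i mod n)}"
        by (auto simp: cycle_edges_def len)
      show "f \<in> ?M"
      proof (cases "Suc i < n")
        case True
        then show ?thesis using gaps_zero_nth[OF \<open>gaps M L\<^sub>2 = 0\<close>, of i] f len by simp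
      next
        case False
        then have "Suc i = n" using i by simp
        then have "f = {last L\<^sub>2, hd L\<^sub>2}"
          using f \<open>L\<^sub>2 \<noteq> []\<close> len by (metis diff_Suc_1 hd_conv_nth last_conv_nth mod_self)
        then show ?thesis by (simp add: e_eq insert_commute)
      qed
    qed
    moreover have "?M \<subseteq> G" using e basics by auto
    ultimately have "cycle_edges L\<^sub>2 \<in> hamilton_cycles n G" "cycle_edges L\<^sub>2 \<subseteq> ?M"
      using dist len n3 by (auto simp: hamilton_cycles_def)
    then show ?thesis using e by blast
  next
    case False
    then obtain xs ys where split: "L\<^sub>2 = xs @ ys" "xs \<noteq> []" "ys \<noteq> []" "{last xs, hd ys} \<notin> M"
      using gaps_pos_split[of M L\<^sub>2] by auto
    have sound: "successively (sound_pair M W) (xs @ ys)" using cb(3)[OF L1 L2] split(1) by simp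
    then have "sound_pair M W (last xs) (hd ys)" using split by (simp add: successively_append_iff)
    then have cut: "last xs \<in> W" "hd ys \<in> W" using split(4) by (auto simp: sound_pair_def)
    have "successively (sound_pair M W) (ys @ xs)"
      using sound split ends by (auto simp: successively_append_iff sound_pair_def)
    then have sound': "successively (sound_pair ?M W) (ys @ xs)"
      by (rule successively_mono) (auto simp: sound_pair_def)
    have "e = {last ys, hd xs}" using e_eq split by (simp add: insert_commute)
    then have "gaps ?M (ys @ xs) = gaps ?M xs + gaps ?M ys" by (simp add: gaps_append)
    also have "\<dots> \<le> gaps M xs + gaps M ys" by (intro add_mono gaps_mono) auto
    finally have "Suc (gaps ?M (ys @ xs)) \<le> gaps M L\<^sub>2" using split by (simp add: gaps_append)
    then have "card ?M + gaps ?M (ys @ xs) \<le> card M + gaps M L"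
      using gaps e basics by simp
    also have "\<dots> \<le> n + work M (W \<union> endangered B)" using c by (simp add: closing_def)
    also have "\<dots> \<le> n + work ?M (W \<union> endangered (B \<union> S))"
      using W endangered_mono[of B "B \<union> S"] by (intro add_left_mono work_mono) auto
    finally have "closing ?M (B \<union> S) W (ys @ xs)"
      using c dist split sound' cut by (auto simp: closing_def)
    moreover have "pot ?M (B \<union> S) \<le> n" using \<open>\<not> (\<exists>u \<in> _. _ u)\<close> by (intro pot_round_idle) (auto simp: not_less)
    ultimately show ?thesis using basic_round[OF e] e by (auto simp: invariant_def)
  qed
qed

lemma invariant_step:
  "\<exists>e \<in> G - (M \<union> B \<union> S). invariant (insert e M) (B \<union> S) \<or>
    (\<exists>F \<in> hamilton_cycles n G. F \<subseteq> insert e M)"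
  using inv merging_step merging_imp_closing closing_step
  unfolding invariant_def by (metis not_le)

end

theorem maker_wins: "maker_wins_within 1 b G (hamilton_cycles n G) (real N)"
proof (rule maker_wins_by_invariant[where Inv = invariant])
  show "invariant {} {}" by (rule invariant_init)
  show "card M < N" if "invariant M B" for M B using that by (rule invariant_bound)
qed (auto intro: invariant_step)

end

section \<open>Edge counts in the random graph\<close>

lemma finite_all_edges [simp]: "finite (all_edges n)"
  by (rule finite_subset[of _ "Pow {..<n}"]) (auto simp: all_edges_def)

lemma card_all_edges_le: "card (all_edges n) \<le> n\<^sup>2"
proof -
  have "card (all_edges n) = n choose 2"
    unfolding all_edges_def using n_subsets[of "{..<n}" 2] by simp
  also have "\<dots> \<le> n\<^sup>2" by (cases "2 \<le> n") (auto intro: binomial_le_pow simp: binomial_eq_0)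
  finally show ?thesis .
qed

lemma finite_set_pmf_random_graph [simp]: "finite (set_pmf (binomial_random_graph n p))"
proof (rule finite_subset)
  show "set_pmf (binomial_random_graph n p) \<subseteq> Pow (all_edges n)"
    by (auto simp: binomial_random_graph_def)
qed simp

text \<open>The moment generating function of a binomial variable; both tails follow with \<open>c = 1\<close> and \<open>c = - 1\<close>.\<close>

lemma expectation_exp_card:
  fixes p c :: real
  assumes p: "0 \<le> p" "p \<le> 1" and T: "T \<subseteq> all_edges n"
  shows "measure_pmf.expectation (binomial_random_graph n p) (\<lambda>E. exp (c * card (E \<inter> T))) =
    (1 - p + p * exp c) ^ card T"
proof -
  let ?X = "all_edges n"
  let ?h = "\<lambda>e y. if e \<in> T \<and> y then exp c else (1::real)"
  have fT: "finite T" using T by (rule finite_subset) simp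
  have "exp (c * card ({e \<in> ?X. f e} \<inter> T)) = (\<Prod>e\<in>?X. ?h e (f e))" for f
  proof -
    have "(\<Prod>e\<in>?X. ?h e (f e)) = (\<Prod>e\<in>{e \<in> ?X. e \<in> T \<and> f e}. exp c)"
      by (rule prod.inter_filter[symmetric]) simp
    also have "{e \<in> ?X. e \<in> T \<and> f e} = {e \<in> ?X. f e} \<inter> T" by auto
    finally show ?thesis by (simp add: exp_of_nat_mult[symmetric] mult.commute)
  qed
  then have "measure_pmf.expectation (binomial_random_graph n p) (\<lambda>E. exp (c * card (E \<inter> T))) =
      measure_pmf.expectation (Pi_pmf ?X False (\<lambda>_. bernoulli_pmf p)) (\<lambda>f. \<Prod>e\<in>?X. ?h e (f e))"
    by (simp add: binomial_random_graph_def)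
  also have "\<dots> = (\<Prod>e\<in>?X. measure_pmf.expectation (bernoulli_pmf p) (?h e))"
    by (rule expectation_prod_Pi_pmf) (auto intro!: integrable_measure_pmf_finite)
  also have "\<dots> = (\<Prod>e\<in>?X. if e \<in> T then 1 - p + p * exp c else 1)"
    using p by (intro prod.cong refl) (auto simp: algebra_simps)
  also have "\<dots> = (\<Prod>e\<in>{e \<in> ?X. e \<in> T}. 1 - p + p * exp c)"
    by (rule prod.inter_filter[symmetric]) simp
  also have "{e \<in> ?X. e \<in> T} = T" using T by auto
  finally show ?thesis by simp
qed

lemma prob_le_expectation:
  assumes "finite (set_pmf \<mu>)" and "\<And>x. 0 \<le> h x" and "\<And>x. x \<in> A \<Longrightarrow> 1 \<le> (h x :: real)"
  shows "measure_pmf.prob \<mu> A \<le> measure_pmf.expectation \<mu> h"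
proof -
  have "measure_pmf.prob \<mu> A = measure_pmf.expectation \<mu> (indicator A)" by simp
  also have "\<dots> \<le> measure_pmf.expectation \<mu> h"
    using assms by (intro integral_mono integrable_measure_pmf_finite) (auto simp: indicator_def)
  finally show ?thesis .
qed

lemma prob_few_edges:
  fixes p m :: real
  assumes p: "0 \<le> p" "p \<le> 1" and T: "T \<subseteq> all_edges n"
  shows "measure_pmf.prob (binomial_random_graph n p) {E. card (E \<inter> T) \<le> m} \<le>
    exp (m - p * card T / 2)"
proof -
  have "measure_pmf.prob (binomial_random_graph n p) {E. card (E \<inter> T) \<le> m} \<le>
      measure_pmf.expectation (binomial_random_graph n p) (\<lambda>E. exp m * exp (- 1 * card (E \<inter> T)))"
    by (intro prob_le_expectation) (auto simp flip: exp_add)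
  also have "\<dots> = exp m * (1 - p + p * exp (- 1)) ^ card T"
    using expectation_exp_card[OF assms, of "- 1"] by simp
  also have "\<dots> \<le> exp m * exp (- p / 2) ^ card T"
  proof (intro mult_left_mono power_mono)
    have "exp (- 1) \<le> (1 / 2 :: real)"
      using exp_ge_add_one_self[of 1] by (simp add: exp_minus field_simps)
    then have "p * exp (- 1) \<le> p * (1 / 2)" using p by (intro mult_left_mono) auto
    then have "1 - p + p * exp (- 1) \<le> 1 + (- p / 2)" by simp
    also have "\<dots> \<le> exp (- p / 2)" by (rule exp_ge_add_one_self)
    finally show "1 - p + p * exp (- 1) \<le> exp (- p / 2)" .
  qed (use p in auto)
  also have "\<dots> = exp (m - p * card T / 2)"
    by (simp add: mult_ac flip: exp_add exp_of_nat_mult)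
  finally show ?thesis .
qed

lemma prob_many_edges:
  fixes p m :: real
  assumes p: "0 \<le> p" "p \<le> 1" and T: "T \<subseteq> all_edges n"
  shows "measure_pmf.prob (binomial_random_graph n p) {E. m \<le> card (E \<inter> T)} \<le>
    exp (2 * p * card T - m)"
proof -
  have "measure_pmf.prob (binomial_random_graph n p) {E. m \<le> card (E \<inter> T)} \<le>
      measure_pmf.expectation (binomial_random_graph n p) (\<lambda>E. exp (- m) * exp (1 * card (E \<inter> T)))"
    by (intro prob_le_expectation) (auto simp flip: exp_add)
  also have "\<dots> = exp (- m) * (1 - p + p * exp 1) ^ card T"
    using expectation_exp_card[OF assms, of 1] by simp
  also have "\<dots> \<le> exp (- m) * exp (2 * p) ^ card T"
  proof (intro mult_left_mono power_mono)
    have "p * exp 1 \<le> p * 3" using p exp_le by (intro mult_left_mono) auto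
    then have "1 - p + p * exp 1 \<le> 1 + 2 * p" by simp
    also have "\<dots> \<le> exp (2 * p)" by (rule exp_ge_add_one_self)
    finally show "1 - p + p * exp 1 \<le> exp (2 * p)" .
    have "0 \<le> p * exp 1" using p by simp
    then show "0 \<le> 1 - p + p * exp 1" using p by linarith
  qed auto
  also have "\<dots> = exp (2 * p * card T - m)"
    by (simp add: mult_ac flip: exp_add exp_of_nat_mult)
  finally show ?thesis .
qed

lemma prob_union_le:
  fixes c :: real
  assumes "finite I" and "\<And>i. i \<in> I \<Longrightarrow> measure_pmf.prob \<mu> (F i) \<le> c"
    and "A \<subseteq> (\<Union>i\<in>I. F i)"
  shows "measure_pmf.prob \<mu> A \<le> card I * c"
proof -
  have "measure_pmf.prob \<mu> A \<le> measure_pmf.prob \<mu> (\<Union>i\<in>I. F i)"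
    using assms(3) by (intro measure_pmf.finite_measure_mono) auto
  also have "\<dots> \<le> (\<Sum>i\<in>I. measure_pmf.prob \<mu> (F i))"
    using assms(1) by (intro measure_pmf.finite_measure_subadditive_finite) auto
  also have "\<dots> \<le> (\<Sum>i\<in>I. c)" using assms(2) by (rule sum_mono)
  finally show ?thesis by simp
qed

text \<open>
  Keeping each edge of the random graph independently with probability \<open>q\<close> gives a random
  graph of density \<open>p * q\<close> inside the given one.
\<close>

lemma random_subgraph_coupling:
  assumes p: "0 \<le> p" "p \<le> 1" and q: "0 \<le> q" "q \<le> 1"
  obtains \<mu> :: "(nat set set \<times> nat set set) pmf"
  where "map_pmf fst \<mu> = binomial_random_graph n p"
    and "map_pmf snd \<mu> = binomial_random_graph n (p * q)"
    and "\<And>G H. (G, H) \<in> set_pmf \<mu> \<Longrightarrow> H \<subseteq> G \<and> G \<subseteq> all_edges n"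
proof -
  let ?X = "all_edges n"
  let ?pq = "\<lambda>_. pair_pmf (bernoulli_pmf p) (bernoulli_pmf q)"
  let ?P = "Pi_pmf ?X (False, False) ?pq"
  define graph where "graph f = {e \<in> ?X. f e}" for f :: "nat set \<Rightarrow> bool"
  define both where "both = (\<lambda>(x::bool, y::bool). x \<and> y)"
  define \<mu> where "\<mu> = map_pmf (\<lambda>f. (graph (fst \<circ> f), graph (both \<circ> f))) ?P"
  have pq: "0 \<le> p * q" "p * q \<le> 1" using p q by (auto intro: mult_le_one)
  have "map_pmf both (pair_pmf (bernoulli_pmf p) (bernoulli_pmf q)) = bernoulli_pmf (p * q)"
  proof (rule pmf_eqI)
    have t: "pmf (map_pmf both (pair_pmf (bernoulli_pmf p) (bernoulli_pmf q))) True = p * q"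
    proof -
      have "both -` {True} = {(True, True)}" by (auto simp: both_def)
      then show ?thesis using p q by (simp add: pmf_map measure_pmf_single pmf_pair)
    qed
    fix y show "pmf (map_pmf both (pair_pmf (bernoulli_pmf p) (bernoulli_pmf q))) y =
        pmf (bernoulli_pmf (p * q)) y"
    proof (cases y)
      case True
      then show ?thesis using t pq by simp
    next
      case False
      then show ?thesis using t pq by (simp add: pmf_False_conv_True)
    qed
  qed
  then have "Pi_pmf ?X False (\<lambda>_. bernoulli_pmf (p * q)) = map_pmf (\<lambda>f. both \<circ> f) ?P"
    using Pi_pmf_map[of ?X both "(False, False)" False ?pq] by (simp add: both_def)
  moreover have "Pi_pmf ?X False (\<lambda>_. bernoulli_pmf p) = map_pmf (\<lambda>f. fst \<circ> f) ?P"
    using Pi_pmf_map[of ?X fst "(False, False)" False ?pq] by (simp add: map_fst_pair_pmf)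
  ultimately have marg: "binomial_random_graph n p = map_pmf (\<lambda>f. graph (fst \<circ> f)) ?P"
    "binomial_random_graph n (p * q) = map_pmf (\<lambda>f. graph (both \<circ> f)) ?P"
    by (simp_all only: binomial_random_graph_def map_pmf_comp graph_def)
  show ?thesis
  proof (rule that)
    show "map_pmf fst \<mu> = binomial_random_graph n p"
      unfolding marg \<mu>_def map_pmf_comp by simp
    show "map_pmf snd \<mu> = binomial_random_graph n (p * q)"
      unfolding marg \<mu>_def map_pmf_comp by simp
    fix G H assume "(G, H) \<in> set_pmf \<mu>"
    then obtain f where "G = graph (fst \<circ> f)" "H = graph (both \<circ> f)" by (auto simp: \<mu>_def)
    then show "H \<subseteq> G \<and> G \<subseteq> all_edges n" by (auto simp: graph_def both_def case_prod_beta)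
  qed
qed

text \<open>
  The coupling is used only through this consequence: it provides a sparse random subgraph without any
  randomness beyond that of \<open>G\<close> in the conclusion.
\<close>

lemma prob_subgraph_ge:
  assumes p: "0 \<le> p" "p \<le> 1" and q: "0 \<le> q" "q \<le> 1"
    and good: "\<And>G H. H \<subseteq> G \<Longrightarrow> G \<subseteq> all_edges n \<Longrightarrow> A G \<Longrightarrow> C H \<Longrightarrow> W G"
  shows "1 - measure_pmf.prob (binomial_random_graph n p) {G. \<not> A G}
     - measure_pmf.prob (binomial_random_graph n (p * q)) {H. H \<subseteq> all_edges n \<and> \<not> C H}
     \<le> measure_pmf.prob (binomial_random_graph n p) {G. W G}"
proof -
  obtain \<mu> :: "(nat set set \<times> nat set set) pmf"
    where 1: "map_pmf fst \<mu> = binomial_random_graph n p"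
    and 2: "map_pmf snd \<mu> = binomial_random_graph n (p * q)"
    and sub: "\<And>G H. (G, H) \<in> set_pmf \<mu> \<Longrightarrow> H \<subseteq> G \<and> G \<subseteq> all_edges n"
    using random_subgraph_coupling[OF p q] by blast
  let ?P = "measure_pmf.prob \<mu>"
  have "?P (- (fst -` {G. W G})) = ?P (- (fst -` {G. W G}) \<inter> set_pmf \<mu>)"
    by (simp add: measure_Int_set_pmf)
  also have "\<dots> \<le> ?P (fst -` {G. \<not> A G} \<union> snd -` {H. H \<subseteq> all_edges n \<and> \<not> C H})"
  proof (rule measure_pmf.finite_measure_mono)
    show "- (fst -` {G. W G}) \<inter> set_pmf \<mu> \<subseteq>
        fst -` {G. \<not> A G} \<union> snd -` {H. H \<subseteq> all_edges n \<and> \<not> C H}"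
    proof
      fix z assume z: "z \<in> - (fst -` {G. W G}) \<inter> set_pmf \<mu>"
      obtain G H where GH: "z = (G, H)" by (cases z)
      then have "H \<subseteq> G" "G \<subseteq> all_edges n" "\<not> W G" using z sub[of G H] by auto
      moreover from this have "\<not> (A G \<and> C H)" using good[of H G] by blast
      ultimately show "z \<in> fst -` {G. \<not> A G} \<union> snd -` {H. H \<subseteq> all_edges n \<and> \<not> C H}"
        using GH by auto
    qed
  qed simp
  also have "\<dots> \<le> ?P (fst -` {G. \<not> A G}) + ?P (snd -` {H. H \<subseteq> all_edges n \<and> \<not> C H})"
    by (intro measure_Un_le) auto
  finally have "?P (- (fst -` {G. W G})) \<le> measure_pmf.prob (binomial_random_graph n p) {G. \<not> A G} +
      measure_pmf.prob (binomial_random_graph n (p * q)) {H. H \<subseteq> all_edges n \<and> \<not> C H}"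
    by (simp flip: 1 2)
  moreover have "?P (- (fst -` {G. W G})) = 1 - ?P (fst -` {G. W G})"
    using measure_pmf.prob_compl[of "fst -` {G. W G}" \<mu>] by (simp add: Compl_eq_Diff_UNIV)
  moreover have "?P (fst -` {G. W G}) = measure_pmf.prob (binomial_random_graph n p) {G. W G}"
    by (simp flip: 1)
  ultimately show ?thesis by linarith
qed

section \<open>Pseudorandomness of the random graph\<close>

lemma obtain_covering_list:
  assumes "finite T" "T \<noteq> {}" "card T \<le> k"
  obtains xs where "set xs = T" "length xs = k"
proof -
  obtain ys where ys: "set ys = T" "distinct ys" using finite_distinct_list[OF assms(1)] by auto
  then have "length ys \<le> k" "ys \<noteq> []" using assms distinct_card[OF ys(2)] by auto
  then have "set (ys @ replicate (k - length ys) (hd ys)) = T"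
    "length (ys @ replicate (k - length ys) (hd ys)) = k"
    using ys(1) by auto
  then show ?thesis using that by blast
qed

lemma prob_low_degree:
  fixes p d :: real
  assumes p: "0 \<le> p" "p \<le> 1" and U: "U \<subseteq> {..<n}" and m: "real m \<le> d"
  shows "measure_pmf.prob (binomial_random_graph n p)
      {H. \<exists>v<n. deg_into U H v < m} \<le> n * exp (d - p * (real (card U) - 1) / 2)"
proof -
  have fU: "finite U" using U by (rule finite_subset) simp
  define T where "T v = (\<lambda>x. {v, x}) ` (U - {v})" for v
  have T: "T v \<subseteq> all_edges n" if "v < n" for v
    using U that by (auto simp: T_def all_edges_def)
  have card_T: "real (card U) - 1 \<le> card (T v)" for v
  proof -
    have "card (T v) = card (U - {v})"
      unfolding T_def by (intro card_image) (auto simp: inj_on_def doubleton_eq_iff)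
    moreover have "card U - 1 \<le> card (U - {v})" using fU by (simp add: card_Diff_singleton_if)
    ultimately show ?thesis by linarith
  qed
  have deg: "card (H \<inter> T v) \<le> deg_into U H v" for H v
  proof -
    have "H \<inter> T v \<subseteq> (\<lambda>x. {v, x}) ` {x \<in> U. {v, x} \<in> H}" by (auto simp: T_def)
    then have "card (H \<inter> T v) \<le> card ((\<lambda>x. {v, x}) ` {x \<in> U. {v, x} \<in> H})"
      using fU by (intro card_mono) auto
    also have "\<dots> \<le> deg_into U H v" unfolding deg_into_def using fU by (intro card_image_le) auto
    finally show ?thesis .
  qed
  have "measure_pmf.prob (binomial_random_graph n p) {H. \<exists>v<n. deg_into U H v < m} \<le>
      card {..<n} * exp (d - p * (real (card U) - 1) / 2)"
  proof (rule prob_union_le)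
    fix v assume v: "v \<in> {..<n}"
    have "measure_pmf.prob (binomial_random_graph n p) {H. card (H \<inter> T v) \<le> d} \<le>
        exp (d - p * card (T v) / 2)"
      using p T v by (intro prob_few_edges) auto
    also have "\<dots> \<le> exp (d - p * (real (card U) - 1) / 2)"
      using mult_left_mono[OF card_T p(1), of v] by simp
    finally show "measure_pmf.prob (binomial_random_graph n p) {H. card (H \<inter> T v) \<le> d} \<le>
        exp (d - p * (real (card U) - 1) / 2)" .
  next
    show "{H. \<exists>v<n. deg_into U H v < m} \<subseteq> (\<Union>v\<in>{..<n}. {H. card (H \<inter> T v) \<le> d})"
    proof
      fix H assume "H \<in> {H. \<exists>v<n. deg_into U H v < m}"
      then obtain v where v: "v < n" "deg_into U H v < m" by auto
      then have "card (H \<inter> T v) < m" using deg[of H v] by simp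
      then have "real (card (H \<inter> T v)) \<le> d" using m by linarith
      then show "H \<in> (\<Union>v\<in>{..<n}. {H. card (H \<inter> T v) \<le> d})" using v by auto
    qed
  qed simp
  then show ?thesis by simp
qed

text \<open>
  For sets of sizes \<open>j\<close> and at most \<open>3 * j\<close> there are \<open>n ^ (4 *
  j)\<close> choices, counted by lists with repetitions, and at most \<open>3 * j\<^sup>2\<close>
  possible edges. Up to \<open>j = s\<close> the expected number of these edges stays so small that
  \<open>D * j / 2\<close> of them appear with probability at most \<open>exp (6 * p * j\<^sup>2 - D * j
  / 2)\<close>, which beats the number of choices by a factor of \<open>n ^ (2 * j)\<close>. The factor
  of two between \<open>D * j\<close> and \<open>D * j / 2\<close> is lost because an edge can be
  counted in both directions.
\<close>

lemma prob_dense_spot: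
  fixes p :: real
  assumes p: "0 \<le> p" "p \<le> 1" and n: "n \<ge> 1" and D: "D \<ge> 1" and s: "s \<le> n"
    and big: "6 * ln n + 6 * p * s \<le> D / 2"
  shows "measure_pmf.prob (binomial_random_graph n p)
     {H. H \<subseteq> all_edges n \<and> (\<exists>S\<subseteq>{..<n}. \<exists>T\<subseteq>{..<n}. S \<noteq> {} \<and> card S \<le> s \<and> card T \<le> 3 * card S \<and>
        D * card S \<le> card {(v, x) \<in> S \<times> T. {v, x} \<in> H})} \<le> n * exp (- 2 * ln n)"
    (is "measure_pmf.prob _ ?bad \<le> _")
proof -
  let ?P = "measure_pmf.prob (binomial_random_graph n p)"
  define between where "between S T = (\<lambda>(a::nat, c). {a, c}) ` (S \<times> T) \<inter> all_edges n" for S T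
  define I where "I j = {xs. set xs \<subseteq> {..<n} \<and> length xs = j} \<times> {ys. set ys \<subseteq> {..<n} \<and> length ys = 3 * j}"
    for j :: nat
  define F where "F j = (\<lambda>(xs, ys). {H. D * j / 2 \<le> card (H \<inter> between (set xs) (set ys))})" for j
  have fI: "finite (I j)" for j by (simp add: I_def finite_lists_length_eq)
  have cI: "card (I j) = n ^ (4 * j)" for j
  proof -
    have "card (I j) = n ^ j * n ^ (3 * j)"
      by (simp add: I_def card_cartesian_product card_lists_length_eq)
    also have "\<dots> = n ^ (j + 3 * j)" by (rule power_add[symmetric])
    finally show ?thesis by simp
  qed
  have level: "?P (\<Union>i\<in>I j. F j i) \<le> exp (- 2 * ln n)" if j: "j \<in> {1..s}" for j
  proof -
    have "?P (\<Union>i\<in>I j. F j i) \<le> card (I j) * exp (2 * p * (3 * real j * real j) - D * j / 2)"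
    proof (rule prob_union_le[OF fI _ order_refl])
      fix i assume i: "i \<in> I j"
      obtain xs ys where xy: "i = (xs, ys)" by (cases i)
      have "card (between (set xs) (set ys)) \<le> card ((\<lambda>(a::nat, c). {a, c}) ` (set xs \<times> set ys))"
        unfolding between_def by (intro card_mono) auto
      also have "\<dots> \<le> card (set xs \<times> set ys)" by (intro card_image_le) auto
      also have "\<dots> \<le> length xs * length ys"
        unfolding card_cartesian_product by (intro mult_le_mono card_length)
      also have "\<dots> = 3 * j * j" using i by (simp add: I_def xy)
      finally have "card (between (set xs) (set ys)) \<le> 3 * j * j" .
      from of_nat_mono[OF this, where 'a = real]
      have "real (card (between (set xs) (set ys))) \<le> 3 * real j * real j" by simp
      then have "2 * p * card (between (set xs) (set ys)) \<le> 2 * p * (3 * real j * real j)"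
        using p by (intro mult_left_mono) auto
      moreover have "?P (F j i) \<le> exp (2 * p * card (between (set xs) (set ys)) - D * j / 2)"
        unfolding F_def xy prod.case using p by (intro prob_many_edges) (auto simp: between_def)
      ultimately show "?P (F j i) \<le> exp (2 * p * (3 * real j * real j) - D * j / 2)"
        by (smt (verit) exp_le_cancel_iff)
    qed
    also have "real (card (I j)) = exp (4 * j * ln n)"
    proof -
      have "exp (real (4 * j) * ln n) = real n ^ (4 * j)"
        unfolding exp_of_nat_mult using n by simp
      then show ?thesis by (simp add: cI)
    qed
    also have "exp (4 * j * ln n) * exp (2 * p * (3 * real j * real j) - D * j / 2) =
        exp (j * (4 * ln n + 6 * p * j - D / 2))"
      by (simp add: algebra_simps flip: exp_add)
    also have "\<dots> \<le> exp (- 2 * ln n)"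
    proof -
      have "6 * p * j \<le> 6 * p * s" using j p by (intro mult_left_mono) auto
      then have "4 * ln n + 6 * p * j - D / 2 \<le> - 2 * ln n" using big by linarith
      then have "j * (4 * ln n + 6 * p * j - D / 2) \<le> j * (- 2 * ln n)"
        by (intro mult_left_mono) auto
      also have "\<dots> \<le> 1 * (- 2 * ln n)"
        using j n by (intro mult_right_mono_neg) auto
      finally show ?thesis by simp
    qed
    finally show ?thesis .
  qed
  have "?P ?bad \<le> card {1..s} * exp (- 2 * ln n)"
  proof (rule prob_union_le[OF _ level])
    show "?bad \<subseteq> (\<Union>j\<in>{1..s}. \<Union>i\<in>I j. F j i)"
    proof
      fix H assume "H \<in> ?bad"
      then obtain S T where H: "H \<subseteq> all_edges n" and S: "S \<subseteq> {..<n}" "S \<noteq> {}" "card S \<le> s"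
        and T: "T \<subseteq> {..<n}" "card T \<le> 3 * card S"
        and many: "D * card S \<le> card {(v, x) \<in> S \<times> T. {v, x} \<in> H}" by blast
      have fin: "finite S" "finite T" using S T finite_subset[of _ "{..<n}"] by auto
      have pos: "card S > 0" using fin S by (simp add: card_gt_0_iff)
      have "T \<noteq> {}"
      proof
        assume "T = {}"
        then show False using many pos D by simp
      qed
      obtain xs where xs: "set xs = S" "length xs = card S"
        using obtain_covering_list[OF fin(1) S(2), of "card S"] by auto
      obtain ys where ys: "set ys = T" "length ys = 3 * card S"
        using obtain_covering_list[OF fin(2) \<open>T \<noteq> {}\<close> T(2)] by auto
      let ?R = "{(v, x) \<in> S \<times> T. {v, x} \<in> H}"
      have fR: "finite ?R" using fin by (auto intro: finite_subset[of _ "S \<times> T"])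
      have "card ?R \<le> 2 * card ((\<lambda>(a, c). {a, c}) ` ?R)" using fR by (rule card_pairs_le)
      also have "\<dots> \<le> 2 * card (H \<inter> between S T)"
        using H finite_subset[OF H] by (intro mult_left_mono card_mono) (auto simp: between_def)
      finally have "D * card S \<le> 2 * card (H \<inter> between S T)" using many by simp
      from of_nat_mono[OF this, where 'a = real]
      have "real D * card S / 2 \<le> card (H \<inter> between S T)" by simp
      then have "H \<in> F (card S) (xs, ys)" by (simp add: F_def xs ys)
      moreover have "(xs, ys) \<in> I (card S)" using S T xs ys by (simp add: I_def)
      moreover have "card S \<in> {1..s}" using pos S by simp
      ultimately show "H \<in> (\<Union>j\<in>{1..s}. \<Union>i\<in>I j. F j i)" by blast
    qed
  qed simp
  also have "\<dots> \<le> n * exp (- 2 * ln n)" using s by (intro mult_right_mono) auto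
  finally show ?thesis .
qed

lemma boosters_edges:
  assumes "distinct L" "set L = {..<n}" "n \<ge> 2"
  shows "boosters U H L \<subseteq> all_edges n"
proof
  fix e assume "e \<in> boosters U H L"
  then obtain L\<^sub>1 L\<^sub>2 where L1: "L\<^sub>1 \<in> rotations U H L" and L2: "L\<^sub>2 \<in> rotations U H (rev L\<^sub>1)"
    and e: "e = {hd L\<^sub>2, last L\<^sub>2}" by (auto simp: boosters_def)
  have d: "distinct L\<^sub>2" "set L\<^sub>2 = {..<n}"
    using rotations_same_set[OF L1] rotations_same_set[OF L2] assms
      rotations_distinct[OF L1] rotations_distinct[OF L2] by auto
  have len: "length L\<^sub>2 = n" using distinct_card[OF d(1)] d(2) by simp
  then have ne: "L\<^sub>2 \<noteq> []" using assms(3) by auto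
  have "hd L\<^sub>2 = L\<^sub>2 ! 0" "last L\<^sub>2 = L\<^sub>2 ! (n - 1)" using ne len by (auto simp: hd_conv_nth last_conv_nth)
  then have "hd L\<^sub>2 \<noteq> last L\<^sub>2" using d(1) len assms(3) by (simp add: nth_eq_iff_index_eq)
  moreover have "hd L\<^sub>2 < n" "last L\<^sub>2 < n"
    using hd_in_set[OF ne] last_in_set[OF ne] d(2) by auto
  ultimately show "e \<in> all_edges n" unfolding e by (simp add: all_edges_def)
qed

text \<open>
  The two kinds of pair sets that must meet the board often. The second clause ranges over all lists and
  all potential edge sets \<open>H\<close> of Maker, so it covers every position that a play adapted to
  the board can reach.
\<close>

definition rich_graph :: "nat \<Rightarrow> nat set \<Rightarrow> nat \<Rightarrow> nat \<Rightarrow> nat set set \<Rightarrow> bool" where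
  "rich_graph n U s Q G \<longleftrightarrow>
     (\<forall>A C. A \<subseteq> {..<n} \<longrightarrow> C \<subseteq> {..<n} \<longrightarrow> A \<inter> C = {} \<longrightarrow> s \<le> card A \<longrightarrow> s \<le> card C \<longrightarrow>
        Q \<le> card (G \<inter> {{a, c} | a c. a \<in> A \<and> c \<in> C})) \<and>
     (\<forall>L H. distinct L \<longrightarrow> set L = {..<n} \<longrightarrow> H \<subseteq> all_edges n \<longrightarrow> card H \<le> 2 * n \<longrightarrow>
        s\<^sup>2 \<le> 2 * card (boosters U H L) \<longrightarrow> Q \<le> card (G \<inter> boosters U H L))"

text \<open>
  The number of pair sets is at most \<open>4 ^ n + n ^ n * (n ^ 3) ^ (2 * n) \<le> n ^ (8 * n)\<close>:
  two vertex sets, or a list of vertices together with a list of \<open>2 * n\<close> edges. Each of the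
  sets has at least \<open>s\<^sup>2 / 2\<close> pairs.
\<close>

lemma prob_not_rich:
  fixes p :: real
  assumes p: "0 \<le> p" "p \<le> 1" and n: "n \<ge> 2"
  shows "measure_pmf.prob (binomial_random_graph n p) {G. \<not> rich_graph n U s Q G} \<le>
    exp (8 * n * ln n + Q - p * s\<^sup>2 / 4)"
proof -
  let ?P = "measure_pmf.prob (binomial_random_graph n p)"
  define pairs where "pairs = (\<lambda>(A :: nat set, C). {{a, c} | a c. a \<in> A \<and> c \<in> C})"
  define boost where "boost = (\<lambda>(L, hs). boosters U (set hs - {{}}) L)"
  define I1 where "I1 = Pow {..<n} \<times> Pow {..<n}"
  define I2 where "I2 = {L. set L \<subseteq> {..<n} \<and> length L = n} \<times>
    {hs. set hs \<subseteq> insert {} (all_edges n) \<and> length hs = 2 * n}"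
  define \<T> where "\<T> = {T \<in> pairs ` I1 \<union> boost ` I2. T \<subseteq> all_edges n \<and> s\<^sup>2 \<le> 2 * card T}"
  have fin: "finite I1" "finite I2"
    by (auto simp: I1_def I2_def finite_lists_length_eq)
  then have f\<T>: "finite \<T>" by (simp add: \<T>_def)
  have "card \<T> \<le> card (pairs ` I1 \<union> boost ` I2)"
    unfolding \<T>_def using fin by (intro card_mono) auto
  also have "\<dots> \<le> card (pairs ` I1) + card (boost ` I2)" by (rule card_Un_le)
  also have "\<dots> \<le> card I1 + card I2" using fin by (intro add_mono card_image_le)
  also have "card I1 \<le> n ^ (7 * n)"
  proof -
    have "card I1 = 2 ^ (2 * n)"
      by (simp add: I1_def card_cartesian_product card_Pow power_add mult_2)
    also have "\<dots> \<le> n ^ (2 * n)" using n by (intro power_mono) auto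
    also have "\<dots> \<le> n ^ (7 * n)" using n by (intro power_increasing) auto
    finally show ?thesis .
  qed
  also have "card I2 \<le> n ^ (7 * n)"
  proof -
    have "card (insert {} (all_edges n)) \<le> n\<^sup>2 + 1"
      using card_all_edges_le[of n] by (intro order_trans[OF card_insert_le_m1]) auto
    also have "\<dots> \<le> 2 * n\<^sup>2" using n by (simp add: Suc_le_eq)
    also have "\<dots> \<le> n * n\<^sup>2" using n by (intro mult_right_mono) auto
    finally have "card (insert {} (all_edges n)) \<le> n ^ 3" by (simp add: power2_eq_square power3_eq_cube)
    then have "card (insert {} (all_edges n)) ^ (2 * n) \<le> (n ^ 3) ^ (2 * n)" by (intro power_mono) auto
    then have "n ^ n * card (insert {} (all_edges n)) ^ (2 * n) \<le> n ^ n * (n ^ 3) ^ (2 * n)"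
      by (intro mult_left_mono) auto
    also have "\<dots> = n ^ (7 * n)" by (simp add: mult_ac flip: power_mult power_add)
    finally show ?thesis
      unfolding I2_def card_cartesian_product
      by (subst (1 2) card_lists_length_eq) auto
  qed
  also have "n ^ (7 * n) + n ^ (7 * n) \<le> n ^ (8 * n)"
  proof -
    have "n ^ (7 * n) + n ^ (7 * n) = 2 * n ^ (7 * n)" by simp
    also have "\<dots> \<le> n ^ n * n ^ (7 * n)"
    proof (rule mult_right_mono)
      have "n \<le> n ^ n" using n by (intro self_le_power) auto
      then show "2 \<le> n ^ n" using n by linarith
    qed simp
    also have "\<dots> = n ^ (8 * n)" by (simp flip: power_add)
    finally show ?thesis .
  qed
  finally have "real (card \<T>) \<le> real (n ^ (8 * n))" by (simp only: of_nat_le_iff)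
  also have "\<dots> = exp (8 * n * ln n)"
  proof -
    have "exp (real (8 * n) * ln n) = real n ^ (8 * n)" unfolding exp_of_nat_mult using n by simp
    then show ?thesis by simp
  qed
  finally have card_\<T>: "real (card \<T>) \<le> exp (8 * n * ln n)" .
  have "?P {G. \<not> rich_graph n U s Q G} \<le> card \<T> * exp (Q - p * s\<^sup>2 / 4)"
  proof (rule prob_union_le[OF f\<T>])
    fix T assume T: "T \<in> \<T>"
    have "?P {G. card (G \<inter> T) \<le> real Q} \<le> exp (Q - p * card T / 2)"
      using T p by (intro prob_few_edges) (auto simp: \<T>_def)
    also have "\<dots> \<le> exp (Q - p * s\<^sup>2 / 4)"
    proof -
      have "s\<^sup>2 \<le> 2 * card T" using T by (simp add: \<T>_def)
      from of_nat_mono[OF this, where 'a = real]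
      have "real s ^ 2 \<le> 2 * real (card T)" by simp
      then have "p * real s ^ 2 \<le> p * (2 * real (card T))" using p(1) by (rule mult_left_mono)
      then show ?thesis by simp
    qed
    finally show "?P {G. card (G \<inter> T) \<le> real Q} \<le> exp (Q - p * s\<^sup>2 / 4)" .
  next
    show "{G. \<not> rich_graph n U s Q G} \<subseteq> (\<Union>T\<in>\<T>. {G. card (G \<inter> T) \<le> real Q})"
    proof (rule subsetI, rule ccontr)
      fix G assume G: "G \<in> {G. \<not> rich_graph n U s Q G}"
        and "G \<notin> (\<Union>T\<in>\<T>. {G. card (G \<inter> T) \<le> real Q})"
      then have many: "Q \<le> card (G \<inter> T)" if "T \<in> \<T>" for T using that by fastforce
      have "Q \<le> card (G \<inter> {{a, c} | a c. a \<in> A \<and> c \<in> C})"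
        if AC: "A \<subseteq> {..<n}" "C \<subseteq> {..<n}" "A \<inter> C = {}" "s \<le> card A" "s \<le> card C" for A C
      proof (rule many)
        let ?T = "{{a, c} | a c. a \<in> A \<and> c \<in> C}"
        have sub: "?T \<subseteq> all_edges n"
        proof
          fix e assume "e \<in> ?T"
          then obtain a c where ac: "e = {a, c}" "a \<in> A" "c \<in> C" by auto
          then have "a \<noteq> c" using AC by auto
          then show "e \<in> all_edges n" using ac AC by (auto simp: all_edges_def)
        qed
        have "s\<^sup>2 \<le> card A * card C" unfolding power2_eq_square using AC by (intro mult_le_mono)
        also have "\<dots> = card (A \<times> C)" by (simp add: card_cartesian_product)
        also have "\<dots> \<le> 2 * card ((\<lambda>(a, c). {a, c}) ` (A \<times> C))"
          using AC finite_subset[of _ "{..<n}"] by (intro card_pairs_le) auto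
        also have "(\<lambda>(a, c). {a, c}) ` (A \<times> C) = ?T" by auto
        finally have "s\<^sup>2 \<le> 2 * card ?T" .
        moreover have "?T \<in> pairs ` I1"
          using AC by (intro image_eqI[of _ _ "(A, C)"]) (auto simp: pairs_def I1_def)
        ultimately show "?T \<in> \<T>" using sub by (simp add: \<T>_def)
      qed
      moreover have "Q \<le> card (G \<inter> boosters U H L)"
        if LH: "distinct L" "set L = {..<n}" "H \<subseteq> all_edges n" "card H \<le> 2 * n"
          "s\<^sup>2 \<le> 2 * card (boosters U H L)" for L H
      proof (rule many)
        have fH: "finite H" using LH(3) by (rule finite_subset) simp
        obtain ys where ys: "set ys = H" "distinct ys" using finite_distinct_list[OF fH] by auto
        have len: "length ys \<le> 2 * n" using distinct_card[OF ys(2)] ys(1) LH by simp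
        \<comment> \<open>The empty set, which is no edge, pads the list to the fixed length.\<close>
        define hs where "hs = ys @ replicate (2 * n - length ys) {}"
        have "{} \<notin> H" using LH(3) by (auto simp: all_edges_def)
        then have hs: "set hs - {{}} = H" "length hs = 2 * n" "set hs \<subseteq> insert {} (all_edges n)"
          using ys len LH(3) by (auto simp: hs_def)
        have "length L = n" using distinct_card[OF LH(1)] LH(2) by simp
        then have "boosters U H L \<in> boost ` I2"
          using hs LH by (intro image_eqI[of _ _ "(L, hs)"]) (auto simp: boost_def I2_def)
        then show "boosters U H L \<in> \<T>"
          using boosters_edges[OF LH(1,2) n] LH(5) by (simp add: \<T>_def)
      qed
      ultimately have "rich_graph n U s Q G" unfolding rich_graph_def by blast
      then show False using G by simp
    qed
  qed
  also have "\<dots> \<le> exp (8 * n * ln n) * exp (Q - p * s\<^sup>2 / 4)"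
    using card_\<T> by (intro mult_right_mono) auto
  finally show ?thesis by (simp add: algebra_simps flip: exp_add)
qed

section \<open>Choice of parameters\<close>

lemma nat_ceiling_bounds: "0 \<le> x \<Longrightarrow> x \<le> real (nat \<lceil>x\<rceil>) \<and> real (nat \<lceil>x\<rceil>) \<le> x + 1"
  by linarith

lemma nat_floor_bounds: "0 \<le> x \<Longrightarrow> x - 1 < real (nat \<lfloor>x\<rfloor>) \<and> real (nat \<lfloor>x\<rfloor>) \<le> x"
  by linarith

lemma maker_wins_within_mono:
  "maker_wins_within a b X \<F> t \<Longrightarrow> t \<le> t' \<Longrightarrow> maker_wins_within a b X \<F> t'"
  unfolding maker_wins_within_def by (meson order_trans)

text \<open>The base of the potential is at least \<open>exp (1 / (4 * b))\<close>, so \<open>r\<close> of order \<open>b * ln n\<close> suffices.\<close>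

lemma danger_growth:
  fixes b r D n :: nat
  assumes b: "b \<ge> 1" and n: "n \<ge> 1" and r: "4 * real b * (ln n + D) < real r"
  shows "real n * 2 ^ D < (4 * real b / (4 * real b - 1)) ^ r"
proof -
  define x where "x = 4 * real b / (4 * real b - 1)"
  have x: "x > 0" "1 - 1 / (4 * real b) = inverse x" using b by (auto simp: x_def field_simps)
  have "inverse x \<le> exp (- (1 / (4 * real b)))"
    using exp_ge_add_one_self[of "- (1 / (4 * real b))"] x(2) by simp
  then have "inverse x \<le> inverse (exp (1 / (4 * real b)))" by (simp add: exp_minus)
  then have "exp (1 / (4 * real b)) \<le> x" using x(1) by (simp add: le_imp_inverse_le inverse_le_iff_le)
  then have "exp (1 / (4 * real b)) ^ r \<le> x ^ r" by (intro power_mono) auto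
  moreover have "exp (1 / (4 * real b)) ^ r = exp (r / (4 * real b))"
    by (simp flip: exp_of_nat_mult)
  moreover have "ln n + D < r / (4 * real b)" using r b by (simp add: pos_less_divide_eq mult_ac)
  ultimately have "exp (ln n + D) < x ^ r" by (smt (verit) exp_less_mono)
  moreover have "exp (ln n + D) = n * exp 1 ^ D"
    using n by (simp add: exp_add flip: exp_of_nat_mult)
  moreover have "real n * 2 ^ D \<le> n * exp 1 ^ D"
    using exp_ge_add_one_self[of 1] by (intro mult_left_mono power_mono) auto
  ultimately show ?thesis by (simp add: x_def)
qed

text \<open>
  All quantities are powers of \<open>l = ln n\<close>. The pivot set has \<open>n / l ^ 5\<close>
  vertices, so that \<open>D = 24 * l\<close> edges for each of them cost \<open>o(n)\<close> moves. The
  sparse subgraph has density \<open>8 * l ^ 8 / n\<close>, which makes the degrees into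
  \<open>U\<close> exceed \<open>l ^ 3\<close>, far above \<open>D\<close>, so that answering at
  endangered vertices is cheap. Its dense spots are larger than \<open>s = n / l ^ 8\<close>. Finally, a
  pair set of size \<open>s\<^sup>2 / 2\<close> has \<open>p * s\<^sup>2 / 2\<close> edges on average,
  which with \<open>p \<ge> l ^ 100 / n\<close> is of order \<open>l ^ 84 * n\<close> and dwarfs both
  \<open>8 * n * l\<close> and the number of claimed edges. In the condition on degrees, \<open>104 * b
  * l + 1\<close> bounds the loss \<open>r\<close> permitted by the potential, because \<open>D \<le> 25
  * l\<close>.
\<close>

lemma win_probability:
  fixes n b :: nat and K l :: real
  defines "l \<equiv> ln (real n)"
  assumes b: "b \<ge> 1" and K: "K > 100"
    and l: "l \<ge> 8" and p1: "l powr K / n \<le> 1"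
    and room_degree: "l ^ 3 / 2 + (104 * b * l + 1) + b + 25 * l \<le> l ^ 3 - 1"
    and room_time: "n + 25 * l * (n / l ^ 5 + 1 + 4 * (n / l ^ 8)) + 4 * b * n * (25 * l) / (l ^ 3 / 2)
      < n + n / l - 1"
    and room_s: "2 \<le> n / l ^ 8"
  shows "1 - exp (8 * n * l + (2 * n + b * (2 * n + 1) + 1) - l ^ 84 * n / 16)
      - (n * exp (l ^ 3 - (8 * l ^ 8 / n) * (n / l ^ 5 - 1) / 2) + n * exp (- 2 * l))
    \<le> measure_pmf.prob (binomial_random_graph n (l powr K / n))
        {E. maker_wins_within 1 b E (hamilton_cycles n E) (n + n / l)}"
proof -
  define p where "p = l powr K / n"
  define p\<^sub>1 where "p\<^sub>1 = 8 * l ^ 8 / n"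
  have n: "n \<ge> 3"
  proof (rule ccontr)
    assume "\<not> ?thesis"
    then have "real n \<le> 2" by simp
    have "n \<noteq> 0" using l by (cases n) (auto simp: l_def)
    then have "l \<le> ln 2" unfolding l_def using \<open>real n \<le> 2\<close> \<open>n \<noteq> 0\<close> by simp
    also have "\<dots> \<le> 2 - 1" by (rule ln_le_minus_one) simp
    finally show False using l by simp
  qed
  have l_pow: "l ^ 100 \<le> l powr K"
  proof -
    have "l ^ 100 = l powr 100" using l by (simp add: powr_numeral)
    also have "\<dots> \<le> l powr K" using l K by (intro powr_mono) auto
    finally show ?thesis .
  qed
  have p: "0 < p" "p \<le> 1" using p1 l n by (auto simp: p_def)
  have p_ge: "l ^ 100 / n \<le> p" unfolding p_def using l_pow by (intro divide_right_mono) auto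
  have "8 * l ^ 8 \<le> l * l ^ 8" using l by (intro mult_right_mono) auto
  also have "\<dots> = l ^ 9" by (simp flip: power_Suc)
  also have "\<dots> \<le> l ^ 100" using l by (intro power_increasing) auto
  also have "\<dots> \<le> l powr K" by (rule l_pow)
  finally have "p\<^sub>1 \<le> p" unfolding p\<^sub>1_def p_def by (intro divide_right_mono) auto
  have p\<^sub>1: "0 \<le> p\<^sub>1" "p\<^sub>1 \<le> 1" using \<open>p\<^sub>1 \<le> p\<close> p l by (auto simp: p\<^sub>1_def)
  \<comment> \<open>The sparse subgraph arises from the board by keeping each edge with probability \<open>q\<close>.\<close>
  define q where "q = p\<^sub>1 / p"
  have q: "0 \<le> q" "q \<le> 1" "p * q = p\<^sub>1" using p p\<^sub>1 \<open>p\<^sub>1 \<le> p\<close> by (auto simp: q_def)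

  define m where "m = nat \<lceil>n / l ^ 5\<rceil>"
  define U where "U = {..<m}"
  define s where "s = nat \<lfloor>n / l ^ 8\<rfloor>"
  define D where "D = nat \<lceil>24 * l\<rceil>"
  define D\<^sub>1 where "D\<^sub>1 = nat \<lfloor>l ^ 3\<rfloor>"
  define \<tau> where "\<tau> = nat \<lfloor>l ^ 3 / 2\<rfloor>"
  define r where "r = nat \<lfloor>4 * real b * (l + D)\<rfloor> + 1"
  define Q where "Q = 2 * n + b * (2 * n + 1) + 1"
  define N where "N = nat \<lfloor>n + n / l\<rfloor>"
  have m: "n / l ^ 5 \<le> m" "m \<le> n / l ^ 5 + 1" using nat_ceiling_bounds[of "n / l ^ 5"] l by (auto simp: m_def)
  have s: "n / l ^ 8 - 1 < s" "s \<le> n / l ^ 8" using nat_floor_bounds[of "n / l ^ 8"] l by (auto simp: s_def)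
  have "24 * l \<le> D \<and> D \<le> 24 * l + 1" unfolding D_def using l by (intro nat_ceiling_bounds) auto
  then have D: "24 * l \<le> D" "D \<le> 25 * l" using l by auto
  have D1: "l ^ 3 - 1 < D\<^sub>1" "D\<^sub>1 \<le> l ^ 3" using nat_floor_bounds[of "l ^ 3"] l by (auto simp: D\<^sub>1_def)
  have \<tau>: "l ^ 3 / 2 - 1 < \<tau>" "\<tau> \<le> l ^ 3 / 2" using nat_floor_bounds[of "l ^ 3 / 2"] l by (auto simp: \<tau>_def)
  have r: "4 * real b * (l + D) < r" "r \<le> 4 * real b * (l + D) + 1"
  proof -
    have "4 * real b * (l + D) - 1 < real (r - 1) \<and> real (r - 1) \<le> 4 * real b * (l + D)"
      unfolding r_def add_diff_cancel_right' using l by (intro nat_floor_bounds) auto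
    moreover have "real (r - 1) = real r - 1" by (simp add: r_def)
    ultimately show "4 * real b * (l + D) < r" "r \<le> 4 * real b * (l + D) + 1" by auto
  qed
  have N: "n + n / l - 1 < N" "N \<le> n + n / l" using nat_floor_bounds[of "n + n / l"] l by (auto simp: N_def)
  have "m \<le> n"
  proof -
    have "n / l ^ 5 \<le> n / 1" using l n by (intro divide_left_mono) auto
    then have "\<lceil>n / l ^ 5\<rceil> \<le> int n" by (simp add: ceiling_le_iff)
    then show ?thesis unfolding m_def by (simp only: nat_le_iff)
  qed
  then have U: "U \<subseteq> {..<n}" "card U = m" by (auto simp: U_def)
  have s_le: "s \<le> n"
  proof -
    have "n / l ^ 8 \<le> n / 1" using l n by (intro divide_left_mono) auto
    then show ?thesis using s(2) by simp
  qed
  have D_pos: "D \<ge> 1" using D(1) l by linarith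

  define spot where "spot H \<longleftrightarrow>
    (\<exists>S\<subseteq>{..<n}. \<exists>T\<subseteq>{..<n}. S \<noteq> {} \<and> card S \<le> s \<and> card T \<le> 3 * card S \<and>
        D * card S \<le> card {(v, x) \<in> S \<times> T. {v, x} \<in> H})" for H
  define C where "C H \<longleftrightarrow> (\<forall>v<n. D\<^sub>1 \<le> deg_into U H v) \<and> \<not> spot H" for H
  have wins: "maker_wins_within 1 b G (hamilton_cycles n G) (n + n / l)"
    if "H \<subseteq> G" "G \<subseteq> all_edges n" "rich_graph n U s Q G" "C H" for G H
  proof -
    interpret good_board n b D D\<^sub>1 \<tau> r s Q N U G H
    proof
      show "D\<^sub>1 \<le> deg_into U H v" if "v < n" for v using that \<open>C H\<close> by (simp add: C_def)
      show "card {(v, x) \<in> S \<times> T. {v, x} \<in> H} < D * card S"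
        if "S \<subseteq> {..<n}" "T \<subseteq> U" "S \<noteq> {}" "card S \<le> s" "card T \<le> 3 * card S" for S T
      proof -
        have "T \<subseteq> {..<n}" using that(2) U(1) by blast
        then have "\<not> D * card S \<le> card {(v, x) \<in> S \<times> T. {v, x} \<in> H}"
          using that \<open>C H\<close> unfolding C_def spot_def by blast
        then show ?thesis by simp
      qed
      show "Q \<le> card (G \<inter> {{a, c} | a c. a \<in> A \<and> c \<in> C})"
        if "A \<subseteq> {..<n}" "C \<subseteq> {..<n}" "A \<inter> C = {}" "s \<le> card A" "s \<le> card C" for A C
        using \<open>rich_graph n U s Q G\<close> that unfolding rich_graph_def by blast
      show "Q \<le> card (G \<inter> boosters U H' L)"
        if "distinct L" "set L = {..<n}" "H' \<subseteq> all_edges n" "card H' \<le> 2 * n"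
          "s\<^sup>2 \<le> 2 * card (boosters U H' L)" for L H'
        using \<open>rich_graph n U s Q G\<close> that unfolding rich_graph_def by blast
      show "2 * n + b * (2 * n + 1) < Q" by (simp add: Q_def)
      show "\<tau> + r + b + D \<le> D\<^sub>1"
      proof -
        have "4 * real b * (l + D) \<le> 4 * real b * (26 * l)"
          using D(2) by (intro mult_left_mono) auto
        also have "\<dots> = 104 * b * l" by simp
        finally have "real r \<le> 104 * b * l + 1" using r(2) by linarith
        then have "real (\<tau> + r + b + D) < real D\<^sub>1 + 1"
          using \<tau>(2) D(2) D1(1) room_degree by simp
        then show ?thesis by linarith
      qed
      show "real n * 2 ^ D < (4 * real b / (4 * real b - 1)) ^ r"
        using b n r(1) by (intro danger_growth) (auto simp: l_def)
      show "real n + real (D * (card U + 4 * s)) + real (4 * b * n * D) / real (\<tau> + 1) < real N"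
      proof -
        have "D * (real m + 4 * s) \<le> 25 * l * (n / l ^ 5 + 1 + 4 * (n / l ^ 8))"
          using D m s l by (intro mult_mono add_mono) auto
        moreover have "4 * b * n * real D / (\<tau> + 1) \<le> 4 * b * n * (25 * l) / (l ^ 3 / 2)"
          using D \<tau>(1) l by (intro frac_le mult_left_mono) auto
        ultimately show ?thesis using room_time N(1) U(2) by (simp add: add.assoc)
      qed
      show "N \<le> 2 * n"
      proof -
        have "n / l \<le> n / 1" using l n by (intro divide_left_mono) auto
        then have "real N \<le> real (2 * n)" using N(2) by simp
        then show ?thesis by linarith
      qed
    qed (use that n b D_pos U in auto)
    show ?thesis using maker_wins N(2) by (rule maker_wins_within_mono)
  qed
  let ?P = "\<lambda>p. measure_pmf.prob (binomial_random_graph n p)"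
  have rich: "?P p {G. \<not> rich_graph n U s Q G} \<le>
      exp (8 * n * l + (2 * n + b * (2 * n + 1) + 1) - l ^ 84 * n / 16)"
  proof -
    define z where "z = n / l ^ 8"
    have "z / 2 \<le> s" using s(1) room_s unfolding z_def[symmetric] by linarith
    then have "n / l ^ 8 / 2 \<le> s" unfolding z_def .
    then have "(n / l ^ 8 / 2) ^ 2 \<le> real s ^ 2" using l by (intro power_mono) auto
    then have "l ^ 100 / n * (n / l ^ 8 / 2) ^ 2 \<le> p * real s ^ 2"
      using p_ge l p by (intro mult_mono) auto
    moreover have "l ^ 100 / n * (n / l ^ 8 / 2) ^ 2 = l ^ 84 * n / 4"
    proof -
      have "l ^ 100 = l ^ 84 * (l ^ 8) ^ 2" by (simp flip: power_mult power_add)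
      then show ?thesis using l n by (simp add: field_simps power2_eq_square)
    qed
    ultimately have "l ^ 84 * n / 4 \<le> p * real s ^ 2" by linarith
    then have "8 * n * l + Q - p * real s ^ 2 / 4 \<le>
        8 * n * l + (2 * n + b * (2 * n + 1) + 1) - l ^ 84 * n / 16"
      by (simp add: Q_def mult.commute)
    moreover have "?P p {G. \<not> rich_graph n U s Q G} \<le> exp (8 * n * l + Q - p * real s ^ 2 / 4)"
      using prob_not_rich[of p n U s Q] p n by (simp add: l_def)
    ultimately show ?thesis by (smt (verit) exp_le_cancel_iff)
  qed
  have "?P p\<^sub>1 {H. H \<subseteq> all_edges n \<and> \<not> C H} \<le>
      ?P p\<^sub>1 ({H. \<exists>v<n. deg_into U H v < D\<^sub>1} \<union> {H. H \<subseteq> all_edges n \<and> spot H})"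
      (is "_ \<le> ?P p\<^sub>1 (?low \<union> ?spot)")
    by (intro measure_pmf.finite_measure_mono) (auto simp: C_def not_le)
  also have "\<dots> \<le> ?P p\<^sub>1 ?low + ?P p\<^sub>1 ?spot" by (intro measure_Un_le) auto
  also have "?P p\<^sub>1 ?low \<le> n * exp (l ^ 3 - p\<^sub>1 * (real (card U) - 1) / 2)"
    using p\<^sub>1 U(1) D1(2) by (rule prob_low_degree)
  also have "\<dots> \<le> n * exp (l ^ 3 - p\<^sub>1 * (n / l ^ 5 - 1) / 2)"
    using mult_left_mono[of "n / l ^ 5 - 1" "real m - 1" p\<^sub>1] m p\<^sub>1 U by (intro mult_left_mono) auto
  also have "?P p\<^sub>1 ?spot \<le> n * exp (- 2 * ln n)"
    unfolding spot_def
  proof (rule prob_dense_spot)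
    have "6 * p\<^sub>1 * s \<le> 6 * p\<^sub>1 * (n / l ^ 8)" using s p\<^sub>1 by (intro mult_left_mono) auto
    also have "\<dots> = 48" using l n by (simp add: p\<^sub>1_def field_simps)
    finally show "6 * ln n + 6 * p\<^sub>1 * s \<le> D / 2" using D(1) l unfolding l_def by linarith
  qed (use p\<^sub>1 n D_pos s_le in auto)
  finally have sparse: "?P p\<^sub>1 {H. H \<subseteq> all_edges n \<and> \<not> C H} \<le>
      n * exp (l ^ 3 - p\<^sub>1 * (n / l ^ 5 - 1) / 2) + n * exp (- 2 * l)" by (simp add: l_def)
  have "1 - ?P p {G. \<not> rich_graph n U s Q G} - ?P (p * q) {H. H \<subseteq> all_edges n \<and> \<not> C H} \<le>
      ?P p {E. maker_wins_within 1 b E (hamilton_cycles n E) (n + n / l)}"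
    using p q by (intro prob_subgraph_ge wins) auto
  then have "1 - exp (8 * n * l + (2 * n + b * (2 * n + 1) + 1) - l ^ 84 * n / 16)
      - (n * exp (l ^ 3 - p\<^sub>1 * (n / l ^ 5 - 1) / 2) + n * exp (- 2 * l)) \<le>
      ?P p {E. maker_wins_within 1 b E (hamilton_cycles n E) (n + n / l)}"
    using rich sparse unfolding q(3) by linarith
  then show ?thesis unfolding p\<^sub>1_def p_def .
qed

theorem theorem1p2:
  fixes b :: nat and K :: real and p :: "nat \<Rightarrow> real"
  assumes "b \<ge> 1" and "K > 100"
    and "\<And>n. p n = ln (real n) powr K / real n"
  shows "\<exists>g :: nat \<Rightarrow> real. g \<in> o(\<lambda>n. real n) \<and>
           asymptotically_almost_surely (\<lambda>n. binomial_random_graph n (p n))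
             (\<lambda>n E. maker_wins_within 1 b E (hamilton_cycles n E) (real n + g n))"
proof (intro exI conjI)
  let ?g = "\<lambda>n::nat. real n / ln (real n)"
  show "?g \<in> o(\<lambda>n. real n)" by real_asymp
  define \<epsilon> where "\<epsilon> n = exp (8 * real n * ln n + (2 * real n + real b * (2 * n + 1) + 1) - ln n ^ 84 * n / 16)
      + (n * exp (ln n ^ 3 - (8 * ln n ^ 8 / n) * (n / ln n ^ 5 - 1) / 2) + n * exp (- 2 * ln n))" for n :: nat
  define pr where "pr n = measure_pmf.prob (binomial_random_graph n (p n))
      {E. maker_wins_within 1 b E (hamilton_cycles n E) (real n + ?g n)}" for n
  have b0: "real b > 0" using assms(1) by simp
  have K0: "K > 0" using assms(2) by simp
  have "\<epsilon> \<longlonglongrightarrow> 0" unfolding \<epsilon>_def using b0 by real_asymp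
  then have lower: "(\<lambda>n. 1 - \<epsilon> n) \<longlonglongrightarrow> 1" using tendsto_diff[OF tendsto_const, of \<epsilon> 0 sequentially 1] by simp
  have "\<forall>\<^sub>F n::nat in sequentially. ln (real n) \<ge> 8" by real_asymp
  moreover have "\<forall>\<^sub>F n::nat in sequentially. ln (real n) powr K / n \<le> 1" using K0 by real_asymp
  moreover have "\<forall>\<^sub>F n::nat in sequentially.
      ln (real n) ^ 3 / 2 + (104 * real b * ln n + 1) + real b + 25 * ln n \<le> ln n ^ 3 - 1"
    using b0 by real_asymp
  moreover have "\<forall>\<^sub>F n::nat in sequentially.
      n + 25 * ln (real n) * (n / ln n ^ 5 + 1 + 4 * (n / ln n ^ 8)) +
        4 * real b * n * (25 * ln n) / (ln n ^ 3 / 2) < n + n / ln n - 1"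
    using b0 by real_asymp
  moreover have "\<forall>\<^sub>F n::nat in sequentially. 2 \<le> n / ln (real n) ^ 8" by real_asymp
  ultimately have "\<forall>\<^sub>F n in sequentially. 1 - \<epsilon> n \<le> pr n"
  proof eventually_elim
    case (elim n)
    then show ?case
      using win_probability[of b K n] assms unfolding \<epsilon>_def pr_def by (simp add: algebra_simps)
  qed
  moreover have "\<forall>\<^sub>F n in sequentially. pr n \<le> 1" by (simp add: pr_def)
  ultimately have "pr \<longlonglongrightarrow> 1" using lower by (rule tendsto_sandwich[OF _ _ _ tendsto_const])
  then show "asymptotically_almost_surely (\<lambda>n. binomial_random_graph n (p n))
      (\<lambda>n E. maker_wins_within 1 b E (hamilton_cycles n E) (real n + ?g n))"
    unfolding asymptotically_almost_surely_def pr_def .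
qed

end
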